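(* Let $p$ be a prime. For every $\alpha>0$, the Hausdorff measure $h^{1/\alpha}$ on the metric space $\mathbb{Q}_p$ with metric $|x-y|_p^\alpha$ is the standard regular Haar measure $\chi$ (i.e. $h^{1/\alpha}(A)=\chi(A)$ for all Borel $A\subset\mathbb{Q}_p$, where $\chi$ is the Haar measure on $(\mathbb{Q}_p,+)$ with $\chi(\mathbb{Z}_p)=1$). Consequently, the local (at every point) and global Hausdorff dimensions of $(\mathbb{Q}_p,|\cdot|_p^\alpha)$ coincide and are equal to $1/\alpha$.
   Context: $|\cdot|_p$ is the standard $p$-adic absolute value with $|p|_p=p^{-1}$. On a metric space $M$, for $\delta>0$ the Hausdorff outer measure is $h^\delta(A)=\lim_{\varepsilon\to+0}\inf\{\sum_i\operatorname{diam}(S_i)^\delta:\ \bigcup_{i=1}^\infty S_i\supseteq A,\ \operatorname{diam}(S_i)\le\varepsilon\}$ (no normalizing constant). The (global) Hausdorff dimension is $D_h(A)=\inf\{\delta:h^\delta(A)=0\}$; the local Hausdorff dimension of $A$ at $x\in A$ is $\inf_U D_h(A\cap U)$ over all open neighborhoods $U$ of $x$. *)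

theory Defs
  imports
    "HOL-Analysis.Analysis"
    "HOL-Algebra.QuotRing"
    "HOL-Computational_Algebra.Primes"
begin

section \<open>The field of p-adic numbers\<close>

definition padic_abs :: "nat \<Rightarrow> rat \<Rightarrow> real" where
  "padic_abs p q =
     (if q = 0 then 0
      else real p powi (int (multiplicity (int p) (snd (quotient_of q))) -
                        int (multiplicity (int p) (fst (quotient_of q)))))"

definition padic_Cauchy_ring :: "nat \<Rightarrow> (nat \<Rightarrow> rat) ring" where
  "padic_Cauchy_ring p =
     \<lparr>carrier = {s. \<forall>e>0. \<exists>N. \<forall>m\<ge>N. \<forall>n\<ge>N. padic_abs p (s m - s n) < e},
      mult = (\<lambda>s t n. s n * t n), one = (\<lambda>n. 1),
      zero = (\<lambda>n. 0), add = (\<lambda>s t n. s n + t n)\<rparr>"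

definition padic_null :: "nat \<Rightarrow> (nat \<Rightarrow> rat) set" where
  "padic_null p = {s. (\<lambda>n. padic_abs p (s n)) \<longlonglongrightarrow> 0}"

text \<open>The completion of the rational numbers: Cauchy sequences modulo null sequences.\<close>

definition Qp :: "nat \<Rightarrow> (nat \<Rightarrow> rat) set ring" where
  "Qp p = padic_Cauchy_ring p Quot padic_null p"

definition Qp_abs :: "nat \<Rightarrow> (nat \<Rightarrow> rat) set \<Rightarrow> real" where
  "Qp_abs p X = (THE r. \<forall>s\<in>X. (\<lambda>n. padic_abs p (s n)) \<longlonglongrightarrow> r)"

definition Zp :: "nat \<Rightarrow> (nat \<Rightarrow> rat) set set" where
  "Zp p = {x \<in> carrier (Qp p). Qp_abs p x \<le> 1}"

text \<open>The value 0 off the carrier is only there because the locale \<^locale>\<open>Metric_space\<close>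
  asks for symmetry and nonnegativity on the whole type.\<close>

definition Qp_dist :: "nat \<Rightarrow> real \<Rightarrow> (nat \<Rightarrow> rat) set \<Rightarrow> (nat \<Rightarrow> rat) set \<Rightarrow> real" where
  "Qp_dist p \<alpha> x y =
     (if x \<in> carrier (Qp p) \<and> y \<in> carrier (Qp p)
      then Qp_abs p (x \<ominus>\<^bsub>Qp p\<^esub> y) powr \<alpha> else 0)"

definition Qp_topology :: "nat \<Rightarrow> (nat \<Rightarrow> rat) set topology" where
  "Qp_topology p = Metric_space.mtopology (carrier (Qp p)) (Qp_dist p 1)"


section \<open>Haar measures\<close>

definition borel_of :: "'a topology \<Rightarrow> 'a measure" where
  "borel_of T = sigma (topspace T) {U. openin T U}"

text \<open>Nonzero left-invariant Radon measures on the Borel sets. Local compactness of the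
  group is not built in.\<close>

definition haar_measure :: "('a, 'b) monoid_scheme \<Rightarrow> 'a topology \<Rightarrow> 'a measure \<Rightarrow> bool" where
  "haar_measure G T \<mu> \<longleftrightarrow>
     sets \<mu> = sets (borel_of T) \<and>
     emeasure \<mu> (topspace T) \<noteq> 0 \<and>
     (\<forall>g\<in>carrier G. \<forall>A\<in>sets \<mu>. emeasure \<mu> ((\<lambda>x. g \<otimes>\<^bsub>G\<^esub> x) ` A) = emeasure \<mu> A) \<and>
     (\<forall>K. compactin T K \<longrightarrow> emeasure \<mu> K < \<infinity>) \<and>
     (\<forall>A\<in>sets \<mu>. emeasure \<mu> A = (INF U\<in>{U. openin T U \<and> A \<subseteq> U}. emeasure \<mu> U)) \<and>
     (\<forall>U. openin T U \<longrightarrow> emeasure \<mu> U = (SUP K\<in>{K. compactin T K \<and> K \<subseteq> U}. emeasure \<mu> K))"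

definition standard_Qp_haar :: "nat \<Rightarrow> (nat \<Rightarrow> rat) set measure \<Rightarrow> bool" where
  "standard_Qp_haar p \<mu> \<longleftrightarrow>
     haar_measure (add_monoid (Qp p)) (Qp_topology p) \<mu> \<and> emeasure \<mu> (Zp p) = 1"


section \<open>Hausdorff measure and dimension\<close>

definition ediam :: "('a \<Rightarrow> 'a \<Rightarrow> real) \<Rightarrow> 'a set \<Rightarrow> ennreal" where
  "ediam d S = (SUP x\<in>S. SUP y\<in>S. ennreal (d x y))"

text \<open>The covering sets have finite diameter, so \<^const>\<open>enn2real\<close> loses nothing here.\<close>

definition hausdorff_premeasure ::
  "'a set \<Rightarrow> ('a \<Rightarrow> 'a \<Rightarrow> real) \<Rightarrow> real \<Rightarrow> real \<Rightarrow> 'a set \<Rightarrow> ennreal" where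
  "hausdorff_premeasure M d \<delta> \<epsilon> A =
     (INF S\<in>{S :: nat \<Rightarrow> 'a set. A \<subseteq> (\<Union>i. S i) \<and>
                (\<forall>i. S i \<subseteq> M \<and> ediam d (S i) \<le> ennreal \<epsilon>)}.
        \<Sum>i. ennreal (enn2real (ediam d (S i)) powr \<delta>))"

definition hausdorff_measure ::
  "'a set \<Rightarrow> ('a \<Rightarrow> 'a \<Rightarrow> real) \<Rightarrow> real \<Rightarrow> 'a set \<Rightarrow> ennreal" where
  "hausdorff_measure M d \<delta> A =
     Lim (at_right 0) (\<lambda>\<epsilon>. hausdorff_premeasure M d \<delta> \<epsilon> A)"

definition hausdorff_dim :: "'a set \<Rightarrow> ('a \<Rightarrow> 'a \<Rightarrow> real) \<Rightarrow> 'a set \<Rightarrow> ennreal" where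
  "hausdorff_dim M d A = (INF \<delta>\<in>{\<delta>. 0 < \<delta> \<and> hausdorff_measure M d \<delta> A = 0}. ennreal \<delta>)"

definition local_hausdorff_dim ::
  "'a set \<Rightarrow> ('a \<Rightarrow> 'a \<Rightarrow> real) \<Rightarrow> 'a set \<Rightarrow> 'a \<Rightarrow> ennreal" where
  "local_hausdorff_dim M d A x =
     (INF U\<in>{U. openin (Metric_space.mtopology M d) U \<and> x \<in> U}. hausdorff_dim M d (A \<inter> U))"


section \<open>Well-definedness\<close>

lemma padic_abs_nonneg: "0 \<le> padic_abs p q"
  by (simp add: padic_abs_def)

lemma padic_abs_zero [simp]: "padic_abs p 0 = 0"
  by (simp add: padic_abs_def)

lemma padic_abs_eq_0: "prime p \<Longrightarrow> padic_abs p q = 0 \<longleftrightarrow> q = 0"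
  by (auto simp: padic_abs_def prime_gt_0_nat)

lemma padic_abs_frac:
  assumes "prime p" "a \<noteq> 0" "b \<noteq> 0"
  shows "padic_abs p (of_int a / of_int b) =
    real p powi (int (multiplicity (int p) b) - int (multiplicity (int p) a))"
proof -
  obtain n d where nd: "quotient_of (of_int a / of_int b) = (n, d)"
    by force
  have d: "d > 0"
    using quotient_of_denom_pos[OF nd] .
  have eq: "of_int a / of_int b = (of_int n / of_int d :: rat)"
    using quotient_of_div[OF nd] .
  then have "of_int (a * d) = (of_int (n * b) :: rat)"
    using assms d by (simp add: field_simps)
  then have nb: "a * d = n * b"
    by (simp only: of_int_eq_iff)
  then have n: "n \<noteq> 0"
    using assms d by auto
  have "prime_elem (int p)"
    using assms by simp
  then have "multiplicity (int p) a + multiplicity (int p) d =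
      multiplicity (int p) n + multiplicity (int p) b"
    using nb n d assms by (metis prime_elem_multiplicity_mult_distrib less_irrefl)
  then have "int (multiplicity (int p) d) - int (multiplicity (int p) n) =
      int (multiplicity (int p) b) - int (multiplicity (int p) a)"
    by linarith
  then show ?thesis
    using assms by (simp add: padic_abs_def nd)
qed

lemma padic_abs_mult:
  assumes "prime p"
  shows "padic_abs p (x * y) = padic_abs p x * padic_abs p y"
proof (cases "x = 0 \<or> y = 0")
  case False
  obtain a b where x: "x = of_int a / of_int b" and b: "b \<noteq> 0"
    by (metis quotient_of_denom_pos quotient_of_div less_irrefl surj_pair)
  obtain c d where y: "y = of_int c / of_int d" and d: "d \<noteq> 0"
    by (metis quotient_of_denom_pos quotient_of_div less_irrefl surj_pair)
  have a: "a \<noteq> 0" and c: "c \<noteq> 0"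
    using False x y by auto
  have xy: "x * y = of_int (a * c) / of_int (b * d)"
    by (simp add: x y)
  have e: "prime_elem (int p)" and p: "real p \<noteq> 0"
    using assms by (auto simp: prime_gt_0_nat)
  show ?thesis
    unfolding xy
    by (subst padic_abs_frac)
      (use a b c d e p assms in
        \<open>auto simp: x y padic_abs_frac prime_elem_multiplicity_mult_distrib
           power_int_add[symmetric] algebra_simps\<close>)
qed auto

lemma padic_abs_uminus: "padic_abs p (- x) = padic_abs p x"
proof (cases "x = 0")
  case False
  have "quotient_of (- x) = (- fst (quotient_of x), snd (quotient_of x))"
    by (simp add: rat_uminus_code split: prod.split)
  moreover have "multiplicity (int p) (- a) = multiplicity (int p) a" for a
    by (rule multiplicity_cong) simp
  ultimately show ?thesis
    by (simp add: padic_abs_def)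
qed auto

lemma padic_abs_add:
  assumes "prime p"
  shows "padic_abs p (x + y) \<le> max (padic_abs p x) (padic_abs p y)"
proof (cases "x = 0 \<or> y = 0 \<or> x + y = 0")
  case True
  then show ?thesis
    by (auto simp: padic_abs_nonneg max_def)
next
  case False
  obtain a b where x: "x = of_int a / of_int b" and b: "b \<noteq> 0"
    by (metis quotient_of_denom_pos quotient_of_div less_irrefl surj_pair)
  obtain c d where y: "y = of_int c / of_int d" and d: "d \<noteq> 0"
    by (metis quotient_of_denom_pos quotient_of_div less_irrefl surj_pair)
  have x': "x = of_int (a * d) / of_int (b * d)" and y': "y = of_int (c * b) / of_int (b * d)"
    using b d by (simp_all add: x y)
  have xy: "x + y = of_int (a * d + c * b) / of_int (b * d)"
    unfolding x' y' by (simp add: add_divide_distrib)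
  let ?m = "multiplicity (int p)"
  have nz: "a * d \<noteq> 0" "c * b \<noteq> 0" "b * d \<noteq> 0"
    using False b d x y by auto
  have nz': "a * d + c * b \<noteq> 0"
    using False unfolding xy by (metis div_0 of_int_0)
  have unit: "\<not> is_unit (int p)"
    using assms by auto
  have "int p ^ min (?m (a * d)) (?m (c * b)) dvd a * d + c * b"
    by (intro dvd_add multiplicity_dvd') auto
  then have "min (?m (a * d)) (?m (c * b)) \<le> ?m (a * d + c * b)"
    using nz nz' unit by (intro multiplicity_geI) auto
  moreover have "real p \<ge> 1"
    using assms prime_ge_1_nat by auto
  ultimately show ?thesis
    unfolding xy unfolding x' y'
      padic_abs_frac[OF assms nz(1,3)] padic_abs_frac[OF assms nz(2,3)]
      padic_abs_frac[OF assms nz' nz(3)]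
    by (auto simp: le_max_iff_disj min_le_iff_disj intro!: power_int_increasing)
qed

lemma padic_abs_triangle:
  "prime p \<Longrightarrow> padic_abs p (x + y) \<le> padic_abs p x + padic_abs p y"
  using padic_abs_add[of p x y] padic_abs_nonneg[of p x] padic_abs_nonneg[of p y] by linarith

lemma padic_abs_diff_commute: "padic_abs p (x - y) = padic_abs p (y - x)"
  using padic_abs_uminus[of p "x - y"] by simp

lemma padic_abs_reverse_triangle:
  assumes "prime p"
  shows "\<bar>padic_abs p x - padic_abs p y\<bar> \<le> padic_abs p (x - y)"
  using padic_abs_triangle[OF assms, of "x - y" y] padic_abs_triangle[OF assms, of "y - x" x]
    padic_abs_diff_commute[of p x y] by simp

lemma padic_Cauchy_iff:
  "s \<in> carrier (padic_Cauchy_ring p) \<longleftrightarrow>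
     (\<forall>e>0. \<exists>N. \<forall>m\<ge>N. \<forall>n\<ge>N. padic_abs p (s m - s n) < e)"
  by (simp add: padic_Cauchy_ring_def)

lemma padic_Cauchy_convergent:
  assumes p: "prime p" and s: "s \<in> carrier (padic_Cauchy_ring p)"
  shows "convergent (\<lambda>n. padic_abs p (s n))"
proof -
  have "Cauchy (\<lambda>n. padic_abs p (s n))"
    unfolding Cauchy_def dist_real_def
    using s[unfolded padic_Cauchy_iff] padic_abs_reverse_triangle[OF p] le_less_trans by meson
  then show ?thesis
    by (simp add: Cauchy_convergent_iff)
qed

lemma padic_Cauchy_bounded:
  assumes p: "prime p" and s: "s \<in> carrier (padic_Cauchy_ring p)"
  obtains B where "B > 0" "\<And>n. padic_abs p (s n) \<le> B"
proof -
  have "Bseq (\<lambda>n. padic_abs p (s n))"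
    using padic_Cauchy_convergent[OF assms] by (rule convergent_imp_Bseq)
  then show ?thesis
    using that by (auto simp: Bseq_def padic_abs_nonneg)
qed

lemma padic_Cauchy_add:
  assumes p: "prime p" and s: "s \<in> carrier (padic_Cauchy_ring p)"
    and t: "t \<in> carrier (padic_Cauchy_ring p)"
  shows "(\<lambda>n. s n + t n) \<in> carrier (padic_Cauchy_ring p)"
  unfolding padic_Cauchy_iff
proof (intro allI impI)
  fix e :: real assume e: "e > 0"
  obtain N where N: "\<And>m n. m \<ge> N \<Longrightarrow> n \<ge> N \<Longrightarrow> padic_abs p (s m - s n) < e"
    using s e unfolding padic_Cauchy_iff by meson
  obtain K where K: "\<And>m n. m \<ge> K \<Longrightarrow> n \<ge> K \<Longrightarrow> padic_abs p (t m - t n) < e"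
    using t e unfolding padic_Cauchy_iff by meson
  have "padic_abs p (s m + t m - (s n + t n)) < e" if "m \<ge> max N K" "n \<ge> max N K" for m n
  proof -
    have "padic_abs p (s m + t m - (s n + t n)) = padic_abs p ((s m - s n) + (t m - t n))"
      by (simp add: algebra_simps)
    also have "\<dots> \<le> max (padic_abs p (s m - s n)) (padic_abs p (t m - t n))"
      by (rule padic_abs_add[OF p])
    also have "\<dots> < e"
      using N K that by simp
    finally show ?thesis .
  qed
  then show "\<exists>N. \<forall>m\<ge>N. \<forall>n\<ge>N. padic_abs p (s m + t m - (s n + t n)) < e"
    by blast
qed

lemma padic_Cauchy_mult:
  assumes p: "prime p" and s: "s \<in> carrier (padic_Cauchy_ring p)"
    and t: "t \<in> carrier (padic_Cauchy_ring p)"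
  shows "(\<lambda>n. s n * t n) \<in> carrier (padic_Cauchy_ring p)"
  unfolding padic_Cauchy_iff
proof (intro allI impI)
  fix e :: real assume e: "e > 0"
  obtain A where A: "A > 0" "\<And>n. padic_abs p (s n) \<le> A"
    using padic_Cauchy_bounded[OF p s] by metis
  obtain B where B: "B > 0" "\<And>n. padic_abs p (t n) \<le> B"
    using padic_Cauchy_bounded[OF p t] by metis
  obtain N where N: "\<And>m n. m \<ge> N \<Longrightarrow> n \<ge> N \<Longrightarrow> padic_abs p (s m - s n) < e / B"
    using s e B by (metis padic_Cauchy_iff divide_pos_pos)
  obtain K where K: "\<And>m n. m \<ge> K \<Longrightarrow> n \<ge> K \<Longrightarrow> padic_abs p (t m - t n) < e / A"
    using t e A by (metis padic_Cauchy_iff divide_pos_pos)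
  have "padic_abs p (s m * t m - s n * t n) < e" if mn: "m \<ge> max N K" "n \<ge> max N K" for m n
  proof -
    have "padic_abs p (s m * t m - s n * t n) =
        padic_abs p (s m * (t m - t n) + (s m - s n) * t n)"
      by (simp add: algebra_simps)
    also have "\<dots> \<le> max (padic_abs p (s m) * padic_abs p (t m - t n))
        (padic_abs p (s m - s n) * padic_abs p (t n))"
      using padic_abs_add[OF p] by (simp add: padic_abs_mult[OF p, symmetric])
    also have "\<dots> < e"
    proof -
      have "padic_abs p (s m) * padic_abs p (t m - t n) \<le> A * padic_abs p (t m - t n)"
        using A by (simp add: mult_right_mono padic_abs_nonneg)
      also have "\<dots> < e"
        using K[of m n] mn A by (simp add: field_simps)
      finally have 1: "padic_abs p (s m) * padic_abs p (t m - t n) < e" .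
      have "padic_abs p (s m - s n) * padic_abs p (t n) \<le> padic_abs p (s m - s n) * B"
        using B by (simp add: mult_left_mono padic_abs_nonneg)
      also have "\<dots> < e"
        using N[of m n] mn B by (simp add: field_simps)
      finally show ?thesis
        using 1 by simp
    qed
    finally show ?thesis .
  qed
  then show "\<exists>N. \<forall>m\<ge>N. \<forall>n\<ge>N. padic_abs p (s m * t m - s n * t n) < e"
    by blast
qed

lemma padic_Cauchy_const: "(\<lambda>n. c) \<in> carrier (padic_Cauchy_ring p)"
  by (simp add: padic_Cauchy_iff)

lemma padic_Cauchy_uminus:
  assumes "s \<in> carrier (padic_Cauchy_ring p)"
  shows "(\<lambda>n. - s n) \<in> carrier (padic_Cauchy_ring p)"
proof -
  have "padic_abs p (- s m - - s n) = padic_abs p (s m - s n)" for m n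
    by (simp add: padic_abs_diff_commute)
  then show ?thesis
    using assms by (simp only: padic_Cauchy_iff)
qed

lemma padic_Cauchy_ring_sel [simp]:
  "mult (padic_Cauchy_ring p) = (\<lambda>s t n. s n * t n)"
  "one (padic_Cauchy_ring p) = (\<lambda>n. 1)"
  "zero (padic_Cauchy_ring p) = (\<lambda>n. 0)"
  "add (padic_Cauchy_ring p) = (\<lambda>s t n. s n + t n)"
  by (simp_all add: padic_Cauchy_ring_def)

lemma cring_padic_Cauchy_ring:
  assumes "prime p"
  shows "cring (padic_Cauchy_ring p)"
proof (rule cringI)
  show "abelian_group (padic_Cauchy_ring p)"
  proof (rule abelian_groupI)
    fix s assume "s \<in> carrier (padic_Cauchy_ring p)"
    then show "\<exists>t\<in>carrier (padic_Cauchy_ring p).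
        t \<oplus>\<^bsub>padic_Cauchy_ring p\<^esub> s = \<zero>\<^bsub>padic_Cauchy_ring p\<^esub>"
      by (intro bexI[of _ "\<lambda>n. - s n"]) (auto intro: padic_Cauchy_uminus)
  qed (auto intro: padic_Cauchy_add[OF assms] padic_Cauchy_const simp: algebra_simps)
  show "Group.comm_monoid (padic_Cauchy_ring p)"
    by (rule comm_monoidI)
      (auto intro: padic_Cauchy_mult[OF assms] padic_Cauchy_const simp: algebra_simps)
qed (auto simp: algebra_simps)

lemma padic_null_Cauchy:
  assumes p: "prime p" and s: "s \<in> padic_null p"
  shows "s \<in> carrier (padic_Cauchy_ring p)"
  unfolding padic_Cauchy_iff
proof (intro allI impI)
  fix e :: real assume "e > 0"
  then obtain N where N: "\<And>n. n \<ge> N \<Longrightarrow> padic_abs p (s n) < e"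
    using s unfolding padic_null_def lim_sequentially by (auto simp: dist_real_def padic_abs_nonneg)
  have "padic_abs p (s m - s n) < e" if "m \<ge> N" "n \<ge> N" for m n
    using padic_abs_add[OF p, of "s m" "- s n"] N[OF that(1)] N[OF that(2)]
    by (simp add: padic_abs_uminus)
  then show "\<exists>N. \<forall>m\<ge>N. \<forall>n\<ge>N. padic_abs p (s m - s n) < e"
    by blast
qed

lemma padic_null_add:
  assumes p: "prime p" and s: "s \<in> padic_null p" and t: "t \<in> padic_null p"
  shows "(\<lambda>n. s n + t n) \<in> padic_null p"
proof -
  have "(\<lambda>n. padic_abs p (s n) + padic_abs p (t n)) \<longlonglongrightarrow> 0"
    using s t tendsto_add[of "\<lambda>n. padic_abs p (s n)" 0 sequentially "\<lambda>n. padic_abs p (t n)" 0]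
    by (simp add: padic_null_def)
  then have "(\<lambda>n. padic_abs p (s n + t n)) \<longlonglongrightarrow> 0"
    by (rule tendsto_sandwich[OF _ _ tendsto_const, rotated 2])
      (auto simp: padic_abs_nonneg padic_abs_triangle[OF p])
  then show ?thesis
    by (simp add: padic_null_def)
qed

lemma padic_null_mult:
  assumes p: "prime p" and s: "s \<in> padic_null p" and t: "t \<in> carrier (padic_Cauchy_ring p)"
  shows "(\<lambda>n. t n * s n) \<in> padic_null p"
proof -
  obtain B where B: "B > 0" "\<And>n. padic_abs p (t n) \<le> B"
    using padic_Cauchy_bounded[OF p t] by metis
  have "(\<lambda>n. B * padic_abs p (s n)) \<longlonglongrightarrow> 0"
    using s by (auto simp: padic_null_def intro: tendsto_mult_right_zero)
  then have "(\<lambda>n. padic_abs p (t n * s n)) \<longlonglongrightarrow> 0"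
    by (rule tendsto_sandwich[OF _ _ tendsto_const, rotated 2])
      (use B in \<open>auto simp: padic_abs_nonneg padic_abs_mult[OF p] mult_right_mono\<close>)
  then show ?thesis
    by (simp add: padic_null_def)
qed

lemma ideal_padic_null:
  assumes p: "prime p"
  shows "ideal (padic_null p) (padic_Cauchy_ring p)"
proof (rule idealI)
  interpret cring "padic_Cauchy_ring p"
    by (rule cring_padic_Cauchy_ring[OF p])
  show "ring (padic_Cauchy_ring p)" ..
  have inv: "\<ominus>\<^bsub>padic_Cauchy_ring p\<^esub> s = (\<lambda>n. - s n)"
    if "s \<in> carrier (padic_Cauchy_ring p)" for s
    using that padic_Cauchy_uminus[OF that] by (intro minus_equality) auto
  show "subgroup (padic_null p) (add_monoid (padic_Cauchy_ring p))"
  proof (rule add.subgroupI)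
    fix s assume s: "s \<in> padic_null p"
    then show "\<ominus>\<^bsub>padic_Cauchy_ring p\<^esub> s \<in> padic_null p"
      using inv[OF padic_null_Cauchy[OF p s]] by (simp add: padic_null_def padic_abs_uminus)
  next
    have "(\<lambda>n. 0) \<in> padic_null p"
      by (simp add: padic_null_def)
    then show "padic_null p \<noteq> {}"
      by blast
  qed (auto intro: padic_null_Cauchy[OF p] padic_null_add[OF p])
next
  fix s t assume st: "s \<in> padic_null p" "t \<in> carrier (padic_Cauchy_ring p)"
  show "t \<otimes>\<^bsub>padic_Cauchy_ring p\<^esub> s \<in> padic_null p"
    using padic_null_mult[OF p st] by simp
  show "s \<otimes>\<^bsub>padic_Cauchy_ring p\<^esub> t \<in> padic_null p"
    using padic_null_mult[OF p st] by (simp add: mult.commute)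
qed

lemma cring_Qp: "prime p \<Longrightarrow> cring (Qp p)"
  unfolding Qp_def by (intro ideal.quotient_is_cring ideal_padic_null cring_padic_Cauchy_ring)

definition Qp_class :: "nat \<Rightarrow> (nat \<Rightarrow> rat) \<Rightarrow> (nat \<Rightarrow> rat) set" where
  "Qp_class p s = padic_null p +>\<^bsub>padic_Cauchy_ring p\<^esub> s"

lemma Qp_class_eq: "Qp_class p s = {\<lambda>n. h n + s n |h. h \<in> padic_null p}"
  by (auto simp: Qp_class_def a_r_coset_def r_coset_def)

lemma carrier_Qp: "carrier (Qp p) = Qp_class p ` carrier (padic_Cauchy_ring p)"
  by (auto simp: Qp_def Qp_class_def FactRing_def A_RCOSETS_def RCOSETS_def a_r_coset_def)

lemma Qp_class_add:
  assumes "prime p" "s \<in> carrier (padic_Cauchy_ring p)" "t \<in> carrier (padic_Cauchy_ring p)"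
  shows "Qp_class p s \<oplus>\<^bsub>Qp p\<^esub> Qp_class p t = Qp_class p (\<lambda>n. s n + t n)"
proof -
  interpret ideal "padic_null p" "padic_Cauchy_ring p"
    by (rule ideal_padic_null[OF assms(1)])
  show ?thesis
    using assms by (simp add: Qp_def Qp_class_def FactRing_def a_rcos_sum)
qed

lemma Qp_class_zero: "\<zero>\<^bsub>Qp p\<^esub> = Qp_class p (\<lambda>n. 0)"
  by (simp add: Qp_def FactRing_def Qp_class_eq)

lemma Qp_class_diff:
  assumes p: "prime p" and s: "s \<in> carrier (padic_Cauchy_ring p)"
    and t: "t \<in> carrier (padic_Cauchy_ring p)"
  shows "Qp_class p s \<ominus>\<^bsub>Qp p\<^esub> Qp_class p t = Qp_class p (\<lambda>n. s n - t n)"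
proof -
  interpret Q: cring "Qp p"
    by (rule cring_Qp[OF p])
  have "Qp_class p (\<lambda>n. - t n) \<oplus>\<^bsub>Qp p\<^esub> Qp_class p t = \<zero>\<^bsub>Qp p\<^esub>"
    by (simp add: Qp_class_add[OF p padic_Cauchy_uminus[OF t] t] Qp_class_zero)
  then have "\<ominus>\<^bsub>Qp p\<^esub> Qp_class p t = Qp_class p (\<lambda>n. - t n)"
    using t padic_Cauchy_uminus[OF t] by (intro Q.minus_equality) (auto simp: carrier_Qp)
  then show ?thesis
    by (simp add: a_minus_def Qp_class_add[OF p s padic_Cauchy_uminus[OF t]])
qed

lemma Qp_class_self: "s \<in> Qp_class p s"
  by (auto simp: Qp_class_eq padic_null_def intro!: exI[of _ "\<lambda>n. 0"])

lemma Qp_abs_class: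
  assumes p: "prime p" and s: "s \<in> carrier (padic_Cauchy_ring p)"
  shows "(\<lambda>n. padic_abs p (s n)) \<longlonglongrightarrow> Qp_abs p (Qp_class p s)"
proof -
  obtain r where r: "(\<lambda>n. padic_abs p (s n)) \<longlonglongrightarrow> r"
    using padic_Cauchy_convergent[OF p s] by (auto simp: convergent_def)
  have "(\<lambda>n. padic_abs p (t n)) \<longlonglongrightarrow> r" if ts: "t \<in> Qp_class p s" for t
  proof -
    obtain h where h: "h \<in> padic_null p" and t: "t = (\<lambda>n. h n + s n)"
      using ts by (auto simp: Qp_class_eq)
    have "(\<lambda>n. padic_abs p (t n) - padic_abs p (s n)) \<longlonglongrightarrow> 0"
    proof (rule Lim_null_comparison)
      show "(\<lambda>n. padic_abs p (h n)) \<longlonglongrightarrow> 0"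
        using h by (simp add: padic_null_def)
      show "\<forall>\<^sub>F n in sequentially. norm (padic_abs p (t n) - padic_abs p (s n)) \<le> padic_abs p (h n)"
        using padic_abs_reverse_triangle[OF p, of "t n" "s n" for n] by (auto simp: t)
    qed
    then show ?thesis
      using tendsto_add[OF _ r] by fastforce
  qed
  then have "Qp_abs p (Qp_class p s) = r"
    unfolding Qp_abs_def
    using Qp_class_self[of s p] LIMSEQ_unique by (intro the_equality) blast+
  then show ?thesis
    using r by simp
qed

lemma Qp_abs_of_rat: "prime p \<Longrightarrow> Qp_abs p (Qp_class p (\<lambda>n. q)) = padic_abs p q"
  using Qp_abs_class[OF _ padic_Cauchy_const] LIMSEQ_unique tendsto_const by blast

lemma Qp_dist_class:
  assumes p: "prime p" and s: "s \<in> carrier (padic_Cauchy_ring p)"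
    and t: "t \<in> carrier (padic_Cauchy_ring p)"
  shows "Qp_dist p \<alpha> (Qp_class p s) (Qp_class p t) =
           Qp_abs p (Qp_class p (\<lambda>n. s n - t n)) powr \<alpha>"
  using assms by (simp add: Qp_dist_def carrier_Qp Qp_class_diff)

lemma padic_Cauchy_diff:
  assumes p: "prime p" and s: "s \<in> carrier (padic_Cauchy_ring p)"
    and t: "t \<in> carrier (padic_Cauchy_ring p)"
  shows "(\<lambda>n. s n - t n) \<in> carrier (padic_Cauchy_ring p)"
  using padic_Cauchy_add[OF p s padic_Cauchy_uminus[OF t]] by simp

lemma Metric_space_Qp:
  assumes p: "prime p" and \<alpha>: "\<alpha> > 0"
  shows "Metric_space (carrier (Qp p)) (Qp_dist p \<alpha>)"
proof
  note [intro] = padic_Cauchy_diff[OF p]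
  have abs_nonneg: "0 \<le> Qp_abs p (Qp_class p s)"
    if "s \<in> carrier (padic_Cauchy_ring p)" for s
    using LIMSEQ_le_const[OF Qp_abs_class[OF p that]] padic_abs_nonneg by blast
  fix x y
  show "0 \<le> Qp_dist p \<alpha> x y"
    by (simp add: Qp_dist_def)
  show "Qp_dist p \<alpha> x y = Qp_dist p \<alpha> y x"
  proof (cases "x \<in> carrier (Qp p) \<and> y \<in> carrier (Qp p)")
    case True
    then obtain s t where st: "s \<in> carrier (padic_Cauchy_ring p)"
      "t \<in> carrier (padic_Cauchy_ring p)" and xy: "x = Qp_class p s" "y = Qp_class p t"
      by (auto simp: carrier_Qp)
    have "Qp_abs p (Qp_class p (\<lambda>n. s n - t n)) = Qp_abs p (Qp_class p (\<lambda>n. t n - s n))"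
      using Qp_abs_class[OF p, of "\<lambda>n. s n - t n"] Qp_abs_class[OF p, of "\<lambda>n. t n - s n"] st
      by (auto simp: padic_abs_diff_commute[of p "s n" "t n" for n] intro: LIMSEQ_unique)
    then show ?thesis
      using st by (simp add: xy Qp_dist_class[OF p])
  qed (auto simp: Qp_dist_def)
  assume "x \<in> carrier (Qp p)" "y \<in> carrier (Qp p)"
  then obtain s t where s: "s \<in> carrier (padic_Cauchy_ring p)"
    and t: "t \<in> carrier (padic_Cauchy_ring p)" and xy: "x = Qp_class p s" "y = Qp_class p t"
    by (auto simp: carrier_Qp)
  interpret Q: cring "Qp p"
    by (rule cring_Qp[OF p])
  show "Qp_dist p \<alpha> x y = 0 \<longleftrightarrow> x = y"
  proof
    assume "x = y"
    then show "Qp_dist p \<alpha> x y = 0"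
      using s t Qp_abs_of_rat[OF p, of 0] by (simp add: xy Qp_dist_class[OF p t t])
  next
    assume "Qp_dist p \<alpha> x y = 0"
    then have "Qp_abs p (Qp_class p (\<lambda>n. s n - t n)) = 0"
      by (simp add: xy Qp_dist_class[OF p s t])
    then have "(\<lambda>n. s n - t n) \<in> padic_null p"
      using Qp_abs_class[OF p padic_Cauchy_diff[OF p s t]] by (simp add: padic_null_def)
    then have h: "(\<lambda>n. s n - t n) \<in> padic_null p" "(\<lambda>n. t n - s n) \<in> padic_null p"
      by (auto simp: padic_null_def padic_abs_diff_commute[of p "s n" "t n" for n])
    have "s \<in> Qp_class p t"
      using h by (auto simp: Qp_class_eq intro!: exI[of _ "\<lambda>n. s n - t n"])
    interpret ideal "padic_null p" "padic_Cauchy_ring p"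
      by (rule ideal_padic_null[OF p])
    show "x = y"
      unfolding xy using \<open>s \<in> Qp_class p t\<close> a_repr_independence' t
      by (simp add: Qp_class_def)
  qed
  fix z assume "z \<in> carrier (Qp p)"
  then obtain u where u: "u \<in> carrier (padic_Cauchy_ring p)" and z: "z = Qp_class p u"
    by (auto simp: carrier_Qp)
  let ?a = "\<lambda>s t. Qp_abs p (Qp_class p (\<lambda>n. s n - t n))"
  have "?a s u \<le> max (?a s t) (?a t u)"
  proof (rule LIMSEQ_le)
    show "(\<lambda>n. padic_abs p (s n - u n)) \<longlonglongrightarrow> ?a s u"
      using s u by (intro Qp_abs_class[OF p]) auto
    show "(\<lambda>n. max (padic_abs p (s n - t n)) (padic_abs p (t n - u n))) \<longlonglongrightarrow> max (?a s t) (?a t u)"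
      using s t u by (intro tendsto_max Qp_abs_class[OF p]) auto
    show "\<exists>N. \<forall>n\<ge>N. padic_abs p (s n - u n) \<le> max (padic_abs p (s n - t n)) (padic_abs p (t n - u n))"
      using padic_abs_add[OF p, of "s n - t n" "t n - u n" for n] by simp
  qed
  moreover have "0 \<le> ?a s t" "0 \<le> ?a t u" "0 \<le> ?a s u"
    using s t u by (auto intro!: abs_nonneg)
  ultimately have "?a s u powr \<alpha> \<le> max (?a s t powr \<alpha>) (?a t u powr \<alpha>)"
    using \<alpha> by (auto simp: le_max_iff_disj intro: powr_mono2)
  also have "\<dots> \<le> ?a s t powr \<alpha> + ?a t u powr \<alpha>"
    by simp
  finally show "Qp_dist p \<alpha> x z \<le> Qp_dist p \<alpha> x y + Qp_dist p \<alpha> y z"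
    unfolding xy z Qp_dist_class[OF p s t] Qp_dist_class[OF p t u] Qp_dist_class[OF p s u] .
qed

lemma hausdorff_premeasure_tendsto:
  "((\<lambda>\<epsilon>. hausdorff_premeasure M d \<delta> \<epsilon> A) \<longlongrightarrow>
      (SUP \<epsilon>\<in>{0<..}. hausdorff_premeasure M d \<delta> \<epsilon> A)) (at_right 0)"
proof (rule order_tendstoI)
  let ?h = "\<lambda>\<epsilon>. hausdorff_premeasure M d \<delta> \<epsilon> A"
  fix a assume "a < (SUP \<epsilon>\<in>{0<..}. ?h \<epsilon>)"
  then obtain e where e: "e > 0" "a < ?h e"
    by (auto simp: less_SUP_iff)
  have "a < ?h \<epsilon>" if "\<epsilon> < e" for \<epsilon>
  proof -
    have "?h e \<le> ?h \<epsilon>"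
      unfolding hausdorff_premeasure_def
      by (rule INF_superset_mono)
        (use that in \<open>auto; meson ennreal_leI less_imp_le order_trans\<close>, simp)
    then show ?thesis
      using e by simp
  qed
  then show "\<forall>\<^sub>F \<epsilon> in at_right 0. a < ?h \<epsilon>"
    using e by (auto simp: eventually_at_right_field)
next
  let ?h = "\<lambda>\<epsilon>. hausdorff_premeasure M d \<delta> \<epsilon> A"
  fix a assume a: "(SUP \<epsilon>\<in>{0<..}. ?h \<epsilon>) < a"
  have "?h \<epsilon> < a" if "\<epsilon> > 0" for \<epsilon>
    using le_less_trans[OF SUP_upper a, of \<epsilon>] that by simp
  then show "\<forall>\<^sub>F \<epsilon> in at_right 0. ?h \<epsilon> < a"
    by (auto simp: eventually_at_right_field intro: exI[of _ 1])
qed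

lemma hausdorff_measure_eq_SUP:
  "hausdorff_measure M d \<delta> A = (SUP \<epsilon>\<in>{0<..}. hausdorff_premeasure M d \<delta> \<epsilon> A)"
  unfolding hausdorff_measure_def
  by (intro tendsto_Lim hausdorff_premeasure_tendsto) simp

end

theory Submission
  imports Defs
begin

text \<open>Write \<open>d\<close> for the metric \<open>|x - y|\<^sub>p\<close>. Replacing \<open>d\<close> by \<open>d powr \<alpha>\<close> raises every diameter to the
power \<open>\<alpha>\<close>, so the \<open>\<delta>\<close>-dimensional Hausdorff measure of \<open>d powr \<alpha>\<close> is the \<open>\<alpha> * \<delta>\<close>-dimensional one
of \<open>d\<close> (\<open>hausdorff_measure_powr\<close>). Everything thus reduces to the one-dimensional Hausdorff measure
\<open>h\<close> of \<open>d\<close>.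

The heart of the matter is that \<open>h\<close> itself is a standard Haar measure, and that nothing else is.

Because \<open>d\<close> is an ultrametric, the points of a ball keep a positive distance from the points outside
it. A set of diameter less than this distance never straddles the ball, which makes the ball
Caratheodory measurable for \<open>h\<close> (\<open>separated_in_lambda_system\<close>). Balls generate the Borel sets, so \<open>h\<close>
is a Borel measure. It is translation invariant since translations are isometries.

The normalization \<open>h (Zp p) = 1\<close> has an easy half: the \<open>p ^ n\<close> residue balls modulo \<open>p ^ n\<close> have
total diameter at most \<open>1\<close>. For the other half, a countable cover of \<open>Zp p\<close> is first enlarged to a
cover by balls at an arbitrarily small cost (\<open>Qp_ball_cover\<close>); by compactness of \<open>Zp p\<close>, finitely many
balls suffice, and counting how many of the integers \<open>0, ..., p ^ N - 1\<close> lie in each of them shows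
that their radii sum up to at least \<open>1\<close> (\<open>Zp_finite_ball_cover\<close>).

Invariance and normalization force the value \<open>p\<^bsup>-n\<^esup>\<close> on every ball of radius \<open>p\<^bsup>-n\<^esup>\<close>
(\<open>invariant_measure_ball\<close>). Balls form an intersection-stable generator, and countably many of them
cover the space, so two standard Haar measures agree. That \<open>h\<close> is a Radon measure follows from the
same economical ball covers (outer regularity) and from the compactness of balls, of which each open
set is a countable union (inner regularity).

Finally, if the \<open>s\<close>-dimensional measure of a set is finite, then all its higher-dimensional measures
vanish. As \<open>h\<close> is positive on balls and finite on each member of a countable ball cover, every set
that contains a ball has dimension \<open>1\<close> with respect to \<open>d\<close>, hence \<open>1 / \<alpha>\<close> with respect to
\<open>d powr \<alpha>\<close>.\<close>

section \<open>Hausdorff outer measures\<close>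

definition admissible_cover :: "'a set \<Rightarrow> ('a \<Rightarrow> 'a \<Rightarrow> real) \<Rightarrow> real \<Rightarrow> 'a set \<Rightarrow> (nat \<Rightarrow> 'a set) \<Rightarrow> bool" where
  "admissible_cover M d \<epsilon> A S \<longleftrightarrow>
     A \<subseteq> (\<Union>i. S i) \<and> (\<forall>i. S i \<subseteq> M \<and> ediam d (S i) \<le> ennreal \<epsilon>)"

definition diam_powr :: "('a \<Rightarrow> 'a \<Rightarrow> real) \<Rightarrow> real \<Rightarrow> 'a set \<Rightarrow> ennreal" where
  "diam_powr d \<delta> S = ennreal (enn2real (ediam d S) powr \<delta>)"

lemma hausdorff_premeasure_eq:
  "hausdorff_premeasure M d \<delta> \<epsilon> A = (INF S\<in>Collect (admissible_cover M d \<epsilon> A). \<Sum>i. diam_powr d \<delta> (S i))"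
  by (simp add: hausdorff_premeasure_def admissible_cover_def[abs_def] diam_powr_def)

lemma hausdorff_premeasure_le:
  "admissible_cover M d \<epsilon> A S \<Longrightarrow> hausdorff_premeasure M d \<delta> \<epsilon> A \<le> (\<Sum>i. diam_powr d \<delta> (S i))"
  unfolding hausdorff_premeasure_eq by (rule INF_lower) simp

lemma hausdorff_premeasure_lessE:
  assumes "hausdorff_premeasure M d \<delta> \<epsilon> A < c"
  obtains S where "admissible_cover M d \<epsilon> A S" "(\<Sum>i. diam_powr d \<delta> (S i)) < c"
  using assms unfolding hausdorff_premeasure_eq INF_less_iff by auto

lemma hausdorff_premeasure_greatest:
  assumes "\<And>S. admissible_cover M d \<epsilon> A S \<Longrightarrow> c \<le> (\<Sum>i. diam_powr d \<delta> (S i))"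
  shows "c \<le> hausdorff_premeasure M d \<delta> \<epsilon> A"
  unfolding hausdorff_premeasure_eq using assms by (intro INF_greatest) auto

lemma ediam_empty [simp]: "ediam d {} = 0"
  by (simp add: ediam_def bot_ennreal)

lemma ediam_mono: "S \<subseteq> T \<Longrightarrow> ediam d S \<le> ediam d T"
  unfolding ediam_def by (intro SUP_subset_mono order_refl)

lemma ediam_ge: "x \<in> S \<Longrightarrow> y \<in> S \<Longrightarrow> ennreal (d x y) \<le> ediam d S"
  unfolding ediam_def by (meson SUP_upper2 order_refl)

lemma ediam_le: "(\<And>x y. x \<in> S \<Longrightarrow> y \<in> S \<Longrightarrow> d x y \<le> r) \<Longrightarrow> ediam d S \<le> ennreal r"
  unfolding ediam_def by (intro SUP_least ennreal_leI)

lemma diam_powr_empty [simp]: "diam_powr d \<delta> {} = 0"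
  by (simp add: diam_powr_def)

lemma hausdorff_premeasure_mono:
  "A \<subseteq> B \<Longrightarrow> hausdorff_premeasure M d \<delta> \<epsilon> A \<le> hausdorff_premeasure M d \<delta> \<epsilon> B"
  by (intro hausdorff_premeasure_greatest hausdorff_premeasure_le) (auto simp: admissible_cover_def)

lemma hausdorff_premeasure_empty [simp]: "hausdorff_premeasure M d \<delta> \<epsilon> {} = 0"
  using hausdorff_premeasure_le[of M d \<epsilon> "{}" "\<lambda>_. {}" \<delta>] by (simp add: admissible_cover_def)

lemma hausdorff_premeasure_le_measure:
  "\<epsilon> > 0 \<Longrightarrow> hausdorff_premeasure M d \<delta> \<epsilon> A \<le> hausdorff_measure M d \<delta> A"
  unfolding hausdorff_measure_eq_SUP by (rule SUP_upper) simp

lemma hausdorff_measure_least: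
  "(\<And>\<epsilon>. \<epsilon> > 0 \<Longrightarrow> hausdorff_premeasure M d \<delta> \<epsilon> A \<le> c) \<Longrightarrow> hausdorff_measure M d \<delta> A \<le> c"
  unfolding hausdorff_measure_eq_SUP by (rule SUP_least) simp

lemma hausdorff_premeasure_tendsto_measure:
  "((\<lambda>\<epsilon>. hausdorff_premeasure M d \<delta> \<epsilon> A) \<longlongrightarrow> hausdorff_measure M d \<delta> A) (at_right 0)"
  unfolding hausdorff_measure_eq_SUP by (rule hausdorff_premeasure_tendsto)

lemma hausdorff_measure_mono:
  "A \<subseteq> B \<Longrightarrow> hausdorff_measure M d \<delta> A \<le> hausdorff_measure M d \<delta> B"
  by (meson hausdorff_measure_least hausdorff_premeasure_le_measure hausdorff_premeasure_mono order_trans)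

lemma hausdorff_measure_empty [simp]: "hausdorff_measure M d \<delta> {} = 0"
  using hausdorff_measure_least[of M d \<delta> "{}" 0] by simp

text \<open>Near-optimal covers of the sets \<open>A n\<close>, with errors \<open>e / 2 ^ Suc n\<close>, are merged into one cover of their
union.\<close>

lemma hausdorff_premeasure_countably_subadditive:
  "hausdorff_premeasure M d \<delta> \<epsilon> (\<Union>n::nat. A n) \<le> (\<Sum>n. hausdorff_premeasure M d \<delta> \<epsilon> (A n))"
proof (rule ennreal_le_epsilon)
  let ?h = "hausdorff_premeasure M d \<delta> \<epsilon>"
  fix e :: real assume e: "0 < e" "(\<Sum>n. ?h (A n)) < Orderings.top"
  then have *: "?h (A n) < ?h (A n) + e * (1/2)^Suc n" for n
    by (auto simp add: less_top dest!: ennreal_suminf_lessD)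
  have "\<exists>S. admissible_cover M d \<epsilon> (A n) S \<and> (\<Sum>i. diam_powr d \<delta> (S i)) \<le> ?h (A n) + e * (1/2)^Suc n" for n
    using hausdorff_premeasure_lessE[OF *] less_imp_le by metis
  then obtain S where S: "\<And>n. admissible_cover M d \<epsilon> (A n) (S n)"
      "\<And>n. (\<Sum>i. diam_powr d \<delta> (S n i)) \<le> ?h (A n) + e * (1/2)^Suc n"
    by metis
  define C where "C = case_prod S \<circ> prod_decode"
  have S1: "A n \<subseteq> (\<Union>i. S n i)" "S n i \<subseteq> M" "ediam d (S n i) \<le> ennreal \<epsilon>" for n i
    using S(1) by (auto simp: admissible_cover_def)
  have "admissible_cover M d \<epsilon> (\<Union>n. A n) C"
    unfolding admissible_cover_def
  proof
    show "(\<Union>n. A n) \<subseteq> (\<Union>i. C i)"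
      using S1(1) by (auto simp add: C_def subset_eq) (metis prod.case prod_encode_inverse)
    show "\<forall>i. C i \<subseteq> M \<and> ediam d (C i) \<le> ennreal \<epsilon>"
      using S1 by (simp add: C_def split_def)
  qed
  then have "?h (\<Union>n. A n) \<le> (\<Sum>i. diam_powr d \<delta> (C i))"
    by (rule hausdorff_premeasure_le)
  also have "\<dots> = (\<Sum>n. \<Sum>i. diam_powr d \<delta> (S n i))"
    using suminf_ennreal_2dimen[of "\<lambda>n. \<Sum>i. diam_powr d \<delta> (S n i)" "\<lambda>(n, i). diam_powr d \<delta> (S n i)"]
    by (simp add: C_def comp_def split_def)
  also have "\<dots> \<le> (\<Sum>n. ?h (A n) + e * (1/2) ^ Suc n)"
    by (intro suminf_le S(2)) auto
  also have "... = (\<Sum>n. ?h (A n)) + (\<Sum>n. ennreal e * ennreal ((1/2) ^ Suc n))"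
    using \<open>0 < e\<close> by (subst suminf_add[symmetric])
       (auto simp del: ennreal_suminf_cmult simp add: ennreal_mult[symmetric])
  also have "\<dots> = (\<Sum>n. ?h (A n)) + e"
    unfolding ennreal_suminf_cmult
    by (subst suminf_ennreal_eq[OF zero_le_power power_half_series]) auto
  finally show "?h (\<Union>n. A n) \<le> (\<Sum>n. ?h (A n)) + e" .
qed

lemma hausdorff_measure_countably_subadditive:
  "hausdorff_measure M d \<delta> (\<Union>n::nat. A n) \<le> (\<Sum>n. hausdorff_measure M d \<delta> (A n))"
proof (rule hausdorff_measure_least)
  fix \<epsilon> :: real assume "\<epsilon> > 0"
  then have "(\<Sum>n. hausdorff_premeasure M d \<delta> \<epsilon> (A n)) \<le> (\<Sum>n. hausdorff_measure M d \<delta> (A n))"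
    by (intro suminf_le hausdorff_premeasure_le_measure) auto
  then show "hausdorff_premeasure M d \<delta> \<epsilon> (\<Union>n. A n) \<le> (\<Sum>n. hausdorff_measure M d \<delta> (A n))"
    using hausdorff_premeasure_countably_subadditive order_trans by blast
qed

lemma outer_measure_space_hausdorff:
  "outer_measure_space (Pow M) (hausdorff_measure M d \<delta>)"
  by (auto simp: outer_measure_space_def positive_def increasing_def countably_subadditive_def
      intro: hausdorff_measure_mono hausdorff_measure_countably_subadditive)

lemma hausdorff_measure_subadditive:
  "hausdorff_measure M d \<delta> (A \<union> B) \<le> hausdorff_measure M d \<delta> A + hausdorff_measure M d \<delta> B"
  using hausdorff_measure_countably_subadditive[of M d \<delta> "binaryset A B"]
  by (simp add: suminf_binaryset_eq UN_binaryset_eq)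

section \<open>Measurability of separated sets\<close>

text \<open>A set of diameter at most \<open>\<epsilon> < r\<close> cannot contain both a point of \<open>B\<close> and a point outside \<open>B\<close>. So each
admissible cover of \<open>E\<close> splits into a cover of \<open>E \<inter> B\<close> and one of \<open>E - B\<close> without any loss.\<close>

lemma hausdorff_premeasure_separated:
  assumes "\<epsilon> < r" "0 \<le> \<epsilon>" and sep: "\<And>x y. x \<in> B \<Longrightarrow> y \<in> M - B \<Longrightarrow> r \<le> d x y"
  shows "hausdorff_premeasure M d \<delta> \<epsilon> (E \<inter> B) + hausdorff_premeasure M d \<delta> \<epsilon> (E - B)
           \<le> hausdorff_premeasure M d \<delta> \<epsilon> E"
proof (rule hausdorff_premeasure_greatest)
  fix S assume S: "admissible_cover M d \<epsilon> E S"
  have dich: "S i \<subseteq> B \<or> S i \<inter> B = {}" for i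
  proof (rule ccontr)
    assume "\<not> ?thesis"
    then obtain x y where xy: "x \<in> S i" "x \<in> B" "y \<in> S i" "y \<in> M - B"
      using S unfolding admissible_cover_def by blast
    then have "ennreal (d x y) \<le> ennreal \<epsilon>"
      using ediam_ge[of x "S i" y d] S by (auto simp: admissible_cover_def intro: order_trans)
    then have "d x y \<le> \<epsilon>"
      using assms(2) by (simp add: ennreal_le_iff)
    then show False
      using sep[OF xy(2,4)] assms(1) by simp
  qed
  have *: "admissible_cover M d \<epsilon> (E \<inter> B) (\<lambda>i. S i \<inter> B)" "admissible_cover M d \<epsilon> (E - B) (\<lambda>i. S i - B)"
    using S by (auto simp: admissible_cover_def intro: order_trans[OF ediam_mono])
  have "hausdorff_premeasure M d \<delta> \<epsilon> (E \<inter> B) + hausdorff_premeasure M d \<delta> \<epsilon> (E - B)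
      \<le> (\<Sum>i. diam_powr d \<delta> (S i \<inter> B)) + (\<Sum>i. diam_powr d \<delta> (S i - B))"
    by (intro add_mono hausdorff_premeasure_le *)
  also have "\<dots> = (\<Sum>i. diam_powr d \<delta> (S i \<inter> B) + diam_powr d \<delta> (S i - B))"
    by (simp add: suminf_add)
  also have "\<dots> = (\<Sum>i. diam_powr d \<delta> (S i))"
  proof (rule suminf_cong)
    show "diam_powr d \<delta> (S i \<inter> B) + diam_powr d \<delta> (S i - B) = diam_powr d \<delta> (S i)" for i
      using dich[of i] by (auto simp: Int_absorb2 Diff_triv Diff_eq_empty_iff[THEN iffD2])
  qed
  finally show "hausdorff_premeasure M d \<delta> \<epsilon> (E \<inter> B) + hausdorff_premeasure M d \<delta> \<epsilon> (E - B)
      \<le> (\<Sum>i. diam_powr d \<delta> (S i))" .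
qed

text \<open>The splitting of covers at every small scale survives the limit and becomes the Caratheodory condition
for \<open>B\<close>.\<close>

lemma separated_in_lambda_system:
  assumes "B \<subseteq> M" "r > 0" and sep: "\<And>x y. x \<in> B \<Longrightarrow> y \<in> M - B \<Longrightarrow> r \<le> d x y"
  shows "B \<in> lambda_system M (Pow M) (hausdorff_measure M d \<delta>)"
proof -
  let ?h = "hausdorff_measure M d \<delta>"
  have "?h (E \<inter> B) + ?h (E - B) = ?h E" for E
  proof (rule antisym)
    show "?h E \<le> ?h (E \<inter> B) + ?h (E - B)"
      using hausdorff_measure_subadditive[of M d \<delta> "E \<inter> B" "E - B"] by (simp add: Un_Diff_Int Un_commute)
    have "hausdorff_premeasure M d \<delta> \<epsilon> (E \<inter> B) + hausdorff_premeasure M d \<delta> \<epsilon> (E - B) \<le> ?h E"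
      if "0 < \<epsilon>" "\<epsilon> < r" for \<epsilon>
      using hausdorff_premeasure_separated[of \<epsilon> r B M d \<delta> E, OF that(2) _ sep]
        hausdorff_premeasure_le_measure[OF that(1), of M d \<delta> E] that(1) by auto
    then have "\<forall>\<^sub>F \<epsilon> in at_right 0. hausdorff_premeasure M d \<delta> \<epsilon> (E \<inter> B) +
        hausdorff_premeasure M d \<delta> \<epsilon> (E - B) \<le> ?h E"
      using \<open>r > 0\<close> by (auto simp: eventually_at_right_field)
    then show "?h (E \<inter> B) + ?h (E - B) \<le> ?h E"
      by (rule tendsto_upperbound[rotated])
        (auto intro!: tendsto_add hausdorff_premeasure_tendsto_measure)
  qed
  moreover have "(M - B) \<inter> E = E - B" if "E \<subseteq> M" for E
    using that by blast
  ultimately show ?thesis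
    using \<open>B \<subseteq> M\<close> by (auto simp: lambda_system_def Int_commute)
qed

lemma measure_space_hausdorff:
  assumes sep: "\<And>B. B \<in> \<B> \<Longrightarrow> B \<subseteq> M \<and> (\<exists>r>0. \<forall>x\<in>B. \<forall>y\<in>M - B. r \<le> d x y)"
  shows "measure_space M (sigma_sets M \<B>) (hausdorff_measure M d \<delta>)"
proof -
  interpret sigma_algebra M "Pow M"
    by (rule sigma_algebra_Pow)
  let ?L = "lambda_system M (Pow M) (hausdorff_measure M d \<delta>)"
  have L: "measure_space M ?L (hausdorff_measure M d \<delta>)"
    by (rule caratheodory_lemma[OF outer_measure_space_hausdorff])
  have "\<B> \<subseteq> ?L"
    using sep separated_in_lambda_system[of _ M _ d \<delta>] by fast
  then have sub: "sigma_sets M \<B> \<subseteq> ?L"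
    using L by (intro sigma_algebra.sigma_sets_subset) (auto simp: measure_space_def)
  moreover have "sigma_algebra M (sigma_sets M \<B>)"
    using sep by (intro sigma_algebra_sigma_sets) auto
  ultimately show ?thesis
    using L unfolding measure_space_def positive_def countably_additive_def by blast
qed

text \<open>The images of the sets of a cover have the same diameters. For an invertible isometry, applying this
to the inverse gives equality.\<close>

lemma hausdorff_measure_isometry_le:
  assumes A: "A \<subseteq> M" and f: "f ` M \<subseteq> M" and iso: "\<And>x y. x \<in> M \<Longrightarrow> y \<in> M \<Longrightarrow> d (f x) (f y) = d x y"
  shows "hausdorff_measure M d \<delta> (f ` A) \<le> hausdorff_measure M d \<delta> A"
proof (rule hausdorff_measure_least)
  fix \<epsilon> :: real assume "\<epsilon> > 0"
  have diam: "ediam d (f ` S) = ediam d S" if "S \<subseteq> M" for S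
    unfolding ediam_def image_image using that iso by (intro SUP_cong refl) (auto simp: subset_iff)
  have "hausdorff_premeasure M d \<delta> \<epsilon> (f ` A) \<le> hausdorff_premeasure M d \<delta> \<epsilon> A"
  proof (rule hausdorff_premeasure_greatest)
    fix S assume S: "admissible_cover M d \<epsilon> A S"
    then have "admissible_cover M d \<epsilon> (f ` A) (\<lambda>i. f ` S i)"
      using f unfolding admissible_cover_def by (auto simp: diam) blast+
    then have "hausdorff_premeasure M d \<delta> \<epsilon> (f ` A) \<le> (\<Sum>i. diam_powr d \<delta> (f ` S i))"
      by (rule hausdorff_premeasure_le)
    also have "\<dots> = (\<Sum>i. diam_powr d \<delta> (S i))"
      using S by (simp add: diam_powr_def diam admissible_cover_def)
    finally show "hausdorff_premeasure M d \<delta> \<epsilon> (f ` A) \<le> (\<Sum>i. diam_powr d \<delta> (S i))" .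
  qed
  then show "hausdorff_premeasure M d \<delta> \<epsilon> (f ` A) \<le> hausdorff_measure M d \<delta> A"
    using hausdorff_premeasure_le_measure[OF \<open>\<epsilon> > 0\<close>] order_trans by blast
qed

section \<open>Change of exponent and dimension\<close>

text \<open>At scale \<open>\<epsilon>\<close>, each summand satisfies \<open>r powr t \<le> \<epsilon> powr (t - s) * r powr s\<close>, and the factor
\<open>\<epsilon> powr (t - s)\<close> tends to \<open>0\<close>.\<close>

lemma hausdorff_measure_eq_0_higher_dim:
  assumes st: "s < t" and fin: "hausdorff_measure M d s A < \<infinity>"
  shows "hausdorff_measure M d t A = 0"
proof -
  \<comment> \<open>The infimum over covers need not be attained, so covers are compared with a larger finite bound.\<close>
  define c where "c = hausdorff_measure M d s A + 1"
  have less: "hausdorff_measure M d s A < c"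
    using fin by (simp add: c_def ennreal_add_left_cancel_less[of _ 0, simplified] less_top[symmetric])
  have "c < \<infinity>"
    using fin by (simp add: c_def less_top[symmetric])
  have bound: "hausdorff_premeasure M d t \<epsilon> A \<le> ennreal (\<epsilon> powr (t - s)) * c" if "\<epsilon> > 0" for \<epsilon>
  proof -
    obtain S where S: "admissible_cover M d \<epsilon> A S" "(\<Sum>i. diam_powr d s (S i)) < c"
      using hausdorff_premeasure_lessE le_less_trans[OF hausdorff_premeasure_le_measure[OF \<open>\<epsilon> > 0\<close>] less] .
    have le: "diam_powr d t (S i) \<le> ennreal (\<epsilon> powr (t - s)) * diam_powr d s (S i)" for i
    proof -
      define r where "r = enn2real (ediam d (S i))"
      have "r \<ge> 0" "r \<le> \<epsilon>"
        using S(1) \<open>\<epsilon> > 0\<close> enn2real_mono[of "ediam d (S i)" "ennreal \<epsilon>"]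
        by (auto simp: admissible_cover_def r_def)
      then have "r powr (t - s) * r powr s \<le> \<epsilon> powr (t - s) * r powr s"
        using st by (intro mult_right_mono powr_mono2) auto
      then have "r powr t \<le> \<epsilon> powr (t - s) * r powr s"
        by (simp add: powr_add[symmetric])
      then show ?thesis
        by (simp add: diam_powr_def r_def[symmetric] ennreal_mult[symmetric])
    qed
    have "hausdorff_premeasure M d t \<epsilon> A \<le> (\<Sum>i. diam_powr d t (S i))"
      by (rule hausdorff_premeasure_le[OF S(1)])
    also have "\<dots> \<le> (\<Sum>i. ennreal (\<epsilon> powr (t - s)) * diam_powr d s (S i))"
      by (intro suminf_le le) auto
    also have "\<dots> \<le> ennreal (\<epsilon> powr (t - s)) * c"
      unfolding ennreal_suminf_cmult using S(2) by (intro mult_left_mono) auto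
    finally show ?thesis .
  qed
  have "((\<lambda>\<epsilon>. \<epsilon> powr (t - s)) \<longlongrightarrow> 0) (at_right 0)"
    using st by (intro tendsto_eq_intros tendsto_zero_powrI) (auto intro: eventually_at_rightI[of 0 1])
  then have "((\<lambda>\<epsilon>. ennreal (\<epsilon> powr (t - s))) \<longlongrightarrow> ennreal 0) (at_right 0)"
    by (intro tendsto_ennrealI)
  then have "((\<lambda>\<epsilon>. ennreal (\<epsilon> powr (t - s)) * c) \<longlongrightarrow> 0 * c) (at_right 0)"
    using \<open>c < \<infinity>\<close> by (intro tendsto_mult_ennreal) auto
  moreover have "\<forall>\<^sub>F \<epsilon> in at_right 0. hausdorff_premeasure M d t \<epsilon> A \<le> ennreal (\<epsilon> powr (t - s)) * c"
    using bound by (auto simp: eventually_at_right_field intro: exI[of _ 1])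
  ultimately have "hausdorff_measure M d t A \<le> 0 * c"
    by (intro tendsto_le[OF _ _ hausdorff_premeasure_tendsto_measure]) auto
  then show ?thesis
    by simp
qed

lemma ediam_le_iff:
  "0 \<le> r \<Longrightarrow> ediam d S \<le> ennreal r \<longleftrightarrow> (\<forall>x\<in>S. \<forall>y\<in>S. d x y \<le> r)"
  by (simp add: ediam_def SUP_le_iff ennreal_le_iff)

lemma ediam_powr_le_iff:
  assumes "\<alpha> > 0" "r \<ge> 0" and nn: "\<And>x y. 0 \<le> d x y"
  shows "ediam (\<lambda>x y. d x y powr \<alpha>) S \<le> ennreal (r powr \<alpha>) \<longleftrightarrow> ediam d S \<le> ennreal r"
proof -
  have "d x y powr \<alpha> \<le> r powr \<alpha> \<longleftrightarrow> d x y \<le> r" for x y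
    using assms powr_less_mono2[of \<alpha> r "d x y"] powr_mono2[of \<alpha> "d x y" r] by (auto simp: not_less[symmetric])
  then show ?thesis
    using assms by (simp add: ediam_le_iff)
qed

lemma enn2real_ediam_powr:
  assumes \<alpha>: "\<alpha> > 0" and nn: "\<And>x y. 0 \<le> d x y" and fin: "ediam d S \<le> ennreal \<epsilon>"
  shows "enn2real (ediam (\<lambda>x y. d x y powr \<alpha>) S) = enn2real (ediam d S) powr \<alpha>"
proof -
  let ?D = "ediam (\<lambda>x y. d x y powr \<alpha>) S"
  define r s where "r = enn2real (ediam d S)" and "s = enn2real ?D"
  have nonneg: "r \<ge> 0" "s \<ge> 0" by (auto simp: r_def s_def)
  have "ediam d S < \<infinity>"
    using fin by (auto simp: less_top[symmetric] top_unique)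
  then have r: "ediam d S = ennreal r"
    by (simp add: r_def less_top)
  then have le: "?D \<le> ennreal (r powr \<alpha>)"
    by (simp add: ediam_powr_le_iff \<alpha> nn nonneg)
  then have "?D < \<infinity>"
    using le_less_trans[OF _ ennreal_less_top] by (simp add: less_top)
  then have s: "?D = ennreal s"
    by (simp add: s_def less_top)
  have "?D \<le> ennreal ((s powr (1 / \<alpha>)) powr \<alpha>)"
    using \<alpha> nonneg by (simp add: s powr_powr)
  then have "ediam d S \<le> ennreal (s powr (1 / \<alpha>))"
    by (subst (asm) ediam_powr_le_iff) (simp_all add: \<alpha> nn)
  then have "r \<le> s powr (1 / \<alpha>)"
    by (simp add: r)
  then have "r powr \<alpha> \<le> (s powr (1 / \<alpha>)) powr \<alpha>"
    using \<alpha> nonneg by (intro powr_mono2) auto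
  moreover have "s \<le> r powr \<alpha>"
    using le by (simp add: s)
  ultimately show ?thesis
    using \<alpha> nonneg by (simp add: powr_powr r_def[symmetric] s_def[symmetric])
qed

lemma hausdorff_premeasure_powr:
  assumes \<alpha>: "\<alpha> > 0" and nn: "\<And>x y. 0 \<le> d x y" and "\<epsilon> > 0"
  shows "hausdorff_premeasure M (\<lambda>x y. d x y powr \<alpha>) \<delta> (\<epsilon> powr \<alpha>) A =
    hausdorff_premeasure M d (\<alpha> * \<delta>) \<epsilon> A"
  unfolding hausdorff_premeasure_eq
proof (rule INF_cong)
  show "Collect (admissible_cover M (\<lambda>x y. d x y powr \<alpha>) (\<epsilon> powr \<alpha>) A) = Collect (admissible_cover M d \<epsilon> A)"
    using assms by (simp add: admissible_cover_def[abs_def] ediam_powr_le_iff)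
  fix S assume "S \<in> Collect (admissible_cover M d \<epsilon> A)"
  then show "(\<Sum>i. diam_powr (\<lambda>x y. d x y powr \<alpha>) \<delta> (S i)) = (\<Sum>i. diam_powr d (\<alpha> * \<delta>) (S i))"
    using enn2real_ediam_powr[where d=d, OF \<alpha> nn, of "S i" \<epsilon> for i]
    by (simp add: diam_powr_def admissible_cover_def powr_powr)
qed

text \<open>Passing from \<open>d\<close> to \<open>d powr \<alpha>\<close> matches the premeasure at scale \<open>\<epsilon>\<close> with the one at scale
\<open>\<epsilon> powr \<alpha>\<close>; in the limit \<open>\<epsilon> \<rightarrow> 0\<close> this reparametrization disappears.\<close>

lemma hausdorff_measure_powr:
  assumes \<alpha>: "\<alpha> > 0" and nn: "\<And>x y. 0 \<le> d x y"
  shows "hausdorff_measure M (\<lambda>x y. d x y powr \<alpha>) \<delta> A = hausdorff_measure M d (\<alpha> * \<delta>) A"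
proof (rule antisym)
  show "hausdorff_measure M d (\<alpha> * \<delta>) A \<le> hausdorff_measure M (\<lambda>x y. d x y powr \<alpha>) \<delta> A"
    by (intro hausdorff_measure_least)
      (auto simp: hausdorff_premeasure_powr[where d=d, OF \<alpha> nn, symmetric] intro!: hausdorff_premeasure_le_measure)
  show "hausdorff_measure M (\<lambda>x y. d x y powr \<alpha>) \<delta> A \<le> hausdorff_measure M d (\<alpha> * \<delta>) A"
  proof (rule hausdorff_measure_least)
    fix \<epsilon> :: real assume \<epsilon>: "\<epsilon> > 0"
    then have "hausdorff_premeasure M (\<lambda>x y. d x y powr \<alpha>) \<delta> ((\<epsilon> powr (1 / \<alpha>)) powr \<alpha>) A
        \<le> hausdorff_measure M d (\<alpha> * \<delta>) A"
      by (subst hausdorff_premeasure_powr) (auto simp: \<alpha> nn intro: hausdorff_premeasure_le_measure)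
    then show "hausdorff_premeasure M (\<lambda>x y. d x y powr \<alpha>) \<delta> \<epsilon> A \<le> hausdorff_measure M d (\<alpha> * \<delta>) A"
      using \<alpha> \<epsilon> by (simp add: powr_powr)
  qed
qed

text \<open>Below \<open>s\<close> no measure of \<open>A\<close> can vanish, since otherwise the \<open>s\<close>-dimensional one would vanish too. Above
\<open>s\<close> all of them vanish, by countable subadditivity: \<open>A\<close> itself may have infinite \<open>s\<close>-dimensional
measure, as the whole field of p-adic numbers does.\<close>

lemma hausdorff_dim_eqI:
  fixes C :: "nat \<Rightarrow> 'a set"
  assumes "s > 0" and pos: "hausdorff_measure M d s A \<noteq> 0"
    and cover: "A \<subseteq> (\<Union>i. C i)" and fin: "\<And>i. hausdorff_measure M d s (C i) < \<infinity>"
  shows "hausdorff_dim M d A = ennreal s"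
  unfolding hausdorff_dim_def
proof (rule antisym)
  show "ennreal s \<le> (INF \<delta>\<in>{\<delta>. 0 < \<delta> \<and> hausdorff_measure M d \<delta> A = 0}. ennreal \<delta>)"
  proof (rule INF_greatest)
    fix \<delta> assume "\<delta> \<in> {\<delta>. 0 < \<delta> \<and> hausdorff_measure M d \<delta> A = 0}"
    then have "\<not> \<delta> < s"
      using pos hausdorff_measure_eq_0_higher_dim[of \<delta> s M d A] by auto
    then show "ennreal s \<le> ennreal \<delta>"
      by (simp add: ennreal_leI)
  qed
  show "(INF \<delta>\<in>{\<delta>. 0 < \<delta> \<and> hausdorff_measure M d \<delta> A = 0}. ennreal \<delta>) \<le> ennreal s"
  proof (rule ennreal_le_epsilon)
    fix e :: real assume "e > 0"
    then have "hausdorff_measure M d (s + e) (C i) = 0" for i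
      using hausdorff_measure_eq_0_higher_dim[OF _ fin] by simp
    then have "hausdorff_measure M d (s + e) (\<Union>i. C i) = 0"
      using hausdorff_measure_countably_subadditive[of M d "s + e" C] by simp
    then have "hausdorff_measure M d (s + e) A = 0"
      using hausdorff_measure_mono[OF cover, of M d "s + e"] by simp
    then have "(INF \<delta>\<in>{\<delta>. 0 < \<delta> \<and> hausdorff_measure M d \<delta> A = 0}. ennreal \<delta>) \<le> ennreal (s + e)"
      using \<open>s > 0\<close> \<open>e > 0\<close> by (intro INF_lower) auto
    then show "(INF \<delta>\<in>{\<delta>. 0 < \<delta> \<and> hausdorff_measure M d \<delta> A = 0}. ennreal \<delta>) \<le> ennreal s + ennreal e"
      using \<open>s > 0\<close> \<open>e > 0\<close> by (simp add: ennreal_plus)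
  qed
qed

section \<open>Arithmetic of the p-adic absolute value\<close>

lemma power_int_prime_less_iff:
  assumes "prime p" shows "real p powi k < real p powi l \<longleftrightarrow> k < l"
  using prime_gt_1_nat[OF assms] power_int_strict_increasing[of k l "real p"]
    power_int_increasing[of l k "real p"] by (auto simp: not_less[symmetric])

text \<open>The nonzero values of the absolute value are integer powers of \<open>p\<close>, so there is a gap below each
power.\<close>

lemma padic_abs_less_power:
  assumes p: "prime p" and less: "padic_abs p q < (1 / real p) ^ n"
  shows "padic_abs p q \<le> (1 / real p) ^ Suc n"
proof (cases "q = 0")
  case False
  obtain k :: int where k: "padic_abs p q = real p powi k"
    using False unfolding padic_abs_def by auto
  have pow: "(1 / real p) ^ m = real p powi (- int m)" for m
    by (simp add: power_int_minus power_one_over inverse_eq_divide)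
  have "k < - int n"
    using less unfolding k pow power_int_prime_less_iff[OF p] .
  then show ?thesis
    unfolding k pow using prime_ge_1_nat[OF p] by (intro power_int_increasing) auto
qed simp

lemma padic_abs_of_int_le_iff:
  assumes p: "prime p"
  shows "padic_abs p (of_int a) \<le> (1 / real p) ^ n \<longleftrightarrow> int p ^ n dvd a"
proof (cases "a = 0")
  case False
  have pow: "(1 / real p) ^ m = real p powi (- int m)" for m
    by (simp add: power_int_minus power_one_over inverse_eq_divide)
  have "padic_abs p (of_int a) = real p powi (- int (multiplicity (int p) a))"
    using padic_abs_frac[OF p False, of 1] by simp
  then have "padic_abs p (of_int a) \<le> (1 / real p) ^ n \<longleftrightarrow> n \<le> multiplicity (int p) a"
    unfolding pow using power_int_prime_less_iff[OF p, of "- int n" "- int (multiplicity (int p) a)"]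
    by (auto simp: not_less[symmetric])
  also have "\<dots> \<longleftrightarrow> int p ^ n dvd a"
    using p False by (intro power_dvd_iff_le_multiplicity[symmetric]) auto
  finally show ?thesis .
qed simp

text \<open>A rational number of absolute value at most \<open>1\<close> is a fraction \<open>c / b\<close> whose denominator is prime to \<open>p\<close>.
The approximating integer is \<open>c * u\<close> modulo \<open>p ^ n\<close>, where \<open>u\<close> inverts \<open>b\<close> modulo \<open>p ^ n\<close>.\<close>

lemma padic_abs_integer_approx:
  assumes p: "prime p" and q: "padic_abs p q \<le> 1"
  shows "\<exists>a<p ^ n. padic_abs p (q - of_nat a) \<le> (1 / real p) ^ n"
proof -
  obtain c b where cb: "quotient_of q = (c, b)"
    by force
  have q_eq: "q = of_int c / of_int b" and b: "b > 0" and cop: "coprime c b"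
    using quotient_of_div[OF cb] quotient_of_denom_pos[OF cb] quotient_of_coprime[OF cb] by auto
  have "\<not> int p dvd b"
  proof
    assume dvd: "int p dvd b"
    then have "\<not> int p dvd c"
      using cop p by (meson coprime_common_divisor not_prime_unit prime_nat_int_transfer)
    then have c: "c \<noteq> 0" "multiplicity (int p) c = 0"
      by (auto simp: not_dvd_imp_multiplicity_0)
    have "multiplicity (int p) b > 0"
      using dvd b p by (simp add: prime_multiplicity_gt_zero_iff)
    then have "real p powi 0 < padic_abs p q"
      using c b unfolding q_eq by (subst padic_abs_frac[OF p]) (simp_all only: power_int_prime_less_iff[OF p], auto)
    then show False
      using q by simp
  qed
  then have "coprime (int p) b"
    using p by (simp add: prime_imp_coprime)
  then have "coprime b (int p ^ n)"
    by (simp add: coprime_commute)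
  then obtain u v where uv: "u * b + v * int p ^ n = 1"
    using bezout_int[of b "int p ^ n"] by auto
  define a where "a = (c * u) mod int p ^ n"
  have pn: "int p ^ n > 0"
    using prime_gt_0_nat[OF p] by simp
  have "int p ^ n dvd c - a * b"
  proof -
    have "int p ^ n dvd c * u - a"
      by (simp add: a_def)
    then have "int p ^ n dvd (c * u - a) * b + c * v * int p ^ n"
      by (intro dvd_add) (simp_all add: dvd_mult2)
    also have "(c * u - a) * b + c * v * int p ^ n = c * (u * b + v * int p ^ n) - a * b"
      by (simp add: algebra_simps)
    finally show ?thesis
      by (simp add: uv)
  qed
  then have "padic_abs p (of_int (c - a * b)) \<le> (1 / real p) ^ n"
    by (simp only: padic_abs_of_int_le_iff[OF p])
  moreover have "padic_abs p (of_int b) = 1"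
    using padic_abs_frac[OF p, of b 1] b \<open>\<not> int p dvd b\<close> by (simp add: not_dvd_imp_multiplicity_0)
  moreover have "(q - of_int a) * of_int b = of_int (c - a * b)"
    using b by (simp add: q_eq field_simps)
  ultimately have "padic_abs p (q - of_int a) \<le> (1 / real p) ^ n"
    using padic_abs_mult[OF p, of "q - of_int a" "of_int b"] by simp
  moreover have "a \<ge> 0" "a < int p ^ n"
    using pn by (auto simp: a_def)
  ultimately show ?thesis
    by (intro exI[of _ "nat a"]) (auto simp: nat_less_iff)
qed

text \<open>Numbers that are congruent modulo \<open>q ^ n\<close> are told apart by their quotients, of which there are
\<open>q ^ (N - n)\<close>.\<close>

lemma card_congruent_le:
  fixes q N n :: nat
  assumes "q > 0" "n \<le> N" and A: "A \<subseteq> {..<q ^ N}"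
    and cong: "\<And>a b. a \<in> A \<Longrightarrow> b \<in> A \<Longrightarrow> int q ^ n dvd int a - int b"
  shows "card A \<le> q ^ (N - n)"
proof -
  have eq: "a mod q ^ n = b mod q ^ n" if "a \<in> A" "b \<in> A" for a b
    using cong[OF that] by (metis mod_eq_dvd_iff of_nat_mod of_nat_power of_nat_eq_iff)
  have "inj_on (\<lambda>a. a div q ^ n) A"
    using eq by (metis (no_types, lifting) div_mult_mod_eq inj_onI)
  moreover have "a div q ^ n < q ^ (N - n)" if "a \<in> A" for a
  proof -
    have "q ^ N = q ^ (N - n) * q ^ n"
      using \<open>n \<le> N\<close> by (simp flip: power_add)
    then show ?thesis
      using that A \<open>q > 0\<close> by (auto intro!: less_mult_imp_div_less)
  qed
  ultimately show ?thesis
    using card_inj_on_le[of "\<lambda>a. a div q ^ n" A "{..<q ^ (N - n)}"] by auto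
qed

section \<open>The ultrametric space of p-adic numbers\<close>

locale padic =
  fixes p :: nat
  assumes prime_p: "prime p"
begin

abbreviation K :: "(nat \<Rightarrow> rat) set set" where "K \<equiv> carrier (Qp p)"
abbreviation d :: "(nat \<Rightarrow> rat) set \<Rightarrow> (nat \<Rightarrow> rat) set \<Rightarrow> real" where "d \<equiv> Qp_dist p 1"
text \<open>Only balls of radius at most \<open>1\<close> are needed: they generate the topology, and countably many of radius \<open>1\<close>
cover the space. All of them are compact and open.\<close>

abbreviation B :: "nat \<Rightarrow> (nat \<Rightarrow> rat) set \<Rightarrow> (nat \<Rightarrow> rat) set set" where
  "B n x \<equiv> Metric_space.mcball K d x ((1 / real p) ^ n)"
abbreviation rat_emb :: "rat \<Rightarrow> (nat \<Rightarrow> rat) set" where "rat_emb q \<equiv> Qp_class p (\<lambda>n. q)"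

sublocale Qp: cring "Qp p"
  by (rule cring_Qp[OF prime_p])

sublocale Metric_space K d
  by (rule Metric_space_Qp[OF prime_p]) simp

lemma Qp_repE:
  assumes "x \<in> K"
  obtains s where "s \<in> carrier (padic_Cauchy_ring p)" "x = Qp_class p s"
  using assms by (auto simp: carrier_Qp)

lemma Qp_abs_nonneg: "x \<in> K \<Longrightarrow> 0 \<le> Qp_abs p x"
  by (metis Qp_repE Qp_abs_class[OF prime_p] LIMSEQ_le_const padic_abs_nonneg)

lemma Qp_dist_eq: "x \<in> K \<Longrightarrow> y \<in> K \<Longrightarrow> d x y = Qp_abs p (x \<ominus>\<^bsub>Qp p\<^esub> y)"
  by (simp add: Qp_dist_def Qp_abs_nonneg)

lemma Qp_dist_tendsto:
  assumes "s \<in> carrier (padic_Cauchy_ring p)" "t \<in> carrier (padic_Cauchy_ring p)"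
  shows "(\<lambda>n. padic_abs p (s n - t n)) \<longlonglongrightarrow> d (Qp_class p s) (Qp_class p t)"
  using Qp_abs_class[OF prime_p padic_Cauchy_diff[OF prime_p assms]] assms
  by (simp add: Qp_dist_eq carrier_Qp Qp_class_diff[OF prime_p])

lemma Qp_dist_ultrametric:
  assumes "x \<in> K" "y \<in> K" "z \<in> K"
  shows "d x z \<le> max (d x y) (d y z)"
proof -
  obtain s where s: "s \<in> carrier (padic_Cauchy_ring p)" "x = Qp_class p s" using Qp_repE assms by blast
  obtain t where t: "t \<in> carrier (padic_Cauchy_ring p)" "y = Qp_class p t" using Qp_repE assms by blast
  obtain u where u: "u \<in> carrier (padic_Cauchy_ring p)" "z = Qp_class p u" using Qp_repE assms by blast
  show ?thesis
    unfolding s(2) t(2) u(2)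
  proof (rule LIMSEQ_le)
    show "(\<lambda>n. padic_abs p (s n - u n)) \<longlonglongrightarrow> d (Qp_class p s) (Qp_class p u)"
      by (intro Qp_dist_tendsto s u)
    show "(\<lambda>n. max (padic_abs p (s n - t n)) (padic_abs p (t n - u n)))
        \<longlonglongrightarrow> max (d (Qp_class p s) (Qp_class p t)) (d (Qp_class p t) (Qp_class p u))"
      by (intro tendsto_max Qp_dist_tendsto s t u)
    show "\<exists>N. \<forall>n\<ge>N. padic_abs p (s n - u n) \<le> max (padic_abs p (s n - t n)) (padic_abs p (t n - u n))"
      using padic_abs_add[OF prime_p, of "s n - t n" "t n - u n" for n] by simp
  qed
qed

lemma Qp_dist_translate:
  assumes "g \<in> K" "x \<in> K" "y \<in> K"
  shows "d (g \<oplus>\<^bsub>Qp p\<^esub> x) (g \<oplus>\<^bsub>Qp p\<^esub> y) = d x y"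
proof -
  have "(g \<oplus>\<^bsub>Qp p\<^esub> x) \<ominus>\<^bsub>Qp p\<^esub> (g \<oplus>\<^bsub>Qp p\<^esub> y) = x \<ominus>\<^bsub>Qp p\<^esub> y"
    using assms by algebra
  then show ?thesis
    using assms by (simp add: Qp_dist_eq)
qed

text \<open>The gap in the values of the absolute value persists in the completion, because non-strict inequalities
pass to the limit.\<close>

lemma Qp_dist_less_power:
  assumes "x \<in> K" "y \<in> K" and less: "d x y < (1 / real p) ^ n"
  shows "d x y \<le> (1 / real p) ^ Suc n"
proof -
  obtain s where s: "s \<in> carrier (padic_Cauchy_ring p)" "x = Qp_class p s" using Qp_repE assms by blast
  obtain t where t: "t \<in> carrier (padic_Cauchy_ring p)" "y = Qp_class p t" using Qp_repE assms by blast
  have lim: "(\<lambda>n. padic_abs p (s n - t n)) \<longlonglongrightarrow> d x y"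
    unfolding s(2) t(2) by (intro Qp_dist_tendsto s t)
  have "\<forall>\<^sub>F m in sequentially. padic_abs p (s m - t m) < (1 / real p) ^ n"
    using order_tendstoD(2)[OF lim less] .
  then have "\<forall>\<^sub>F m in sequentially. padic_abs p (s m - t m) \<le> (1 / real p) ^ Suc n"
    by eventually_elim (rule padic_abs_less_power[OF prime_p])
  then show ?thesis
    using tendsto_upperbound[OF lim] by simp
qed

lemma rat_emb_closed [simp]: "rat_emb q \<in> K"
  by (auto simp: carrier_Qp padic_Cauchy_const)

lemma rat_emb_0: "rat_emb 0 = \<zero>\<^bsub>Qp p\<^esub>"
  by (simp add: Qp_class_zero)

lemma Qp_dist_rat_emb: "d (rat_emb a) (rat_emb b) = padic_abs p (a - b)"
  using LIMSEQ_unique[OF Qp_dist_tendsto[OF padic_Cauchy_const padic_Cauchy_const] tendsto_const] by simp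

lemma Qp_rat_dense:
  assumes "x \<in> K" "e > 0"
  obtains q where "d x (rat_emb q) < e"
proof -
  obtain s where s: "s \<in> carrier (padic_Cauchy_ring p)" "x = Qp_class p s" using Qp_repE assms by blast
  obtain N where N: "\<And>m n. m \<ge> N \<Longrightarrow> n \<ge> N \<Longrightarrow> padic_abs p (s m - s n) < e / 2"
    using s(1) \<open>e > 0\<close> half_gt_zero unfolding padic_Cauchy_iff by meson
  have "\<forall>\<^sub>F m in sequentially. padic_abs p (s m - s N) \<le> e / 2"
    using N by (auto simp: eventually_sequentially intro!: exI[of _ N] less_imp_le)
  then have "d x (rat_emb (s N)) \<le> e / 2"
    unfolding s(2) by (rule tendsto_upperbound[OF Qp_dist_tendsto[OF s(1) padic_Cauchy_const]]) simp
  then have "d x (rat_emb (s N)) < e"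
    using \<open>e > 0\<close> by linarith
  then show ?thesis
    by (rule that)
qed

text \<open>A Cauchy sequence of p-adic numbers is shadowed by a sequence \<open>q\<close> of rational numbers whose distance
from it tends to \<open>0\<close>. Then \<open>q\<close> is Cauchy, and the p-adic number that it represents is the limit of both.\<close>

lemma mcomplete_Qp: "mcomplete"
  unfolding mcomplete_def
proof (intro allI impI)
  fix \<sigma> assume \<sigma>: "MCauchy \<sigma>"
  then have K: "\<sigma> n \<in> K" for n
    by (auto simp: MCauchy_def)
  have "\<exists>q. d (\<sigma> n) (rat_emb q) < 1 / real (Suc n)" for n
    using Qp_rat_dense[OF K, of "1 / real (Suc n)"] by auto
  then obtain q where q: "\<And>n. d (\<sigma> n) (rat_emb (q n)) < 1 / real (Suc n)"
    by metis
  have q_lim: "(\<lambda>n. d (\<sigma> n) (rat_emb (q n))) \<longlonglongrightarrow> 0"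
    by (rule tendsto_sandwich[OF _ _ tendsto_const LIMSEQ_inverse_real_of_nat])
      (use q[THEN less_imp_le] in \<open>auto simp: inverse_eq_divide\<close>)
  have q_Cauchy: "q \<in> carrier (padic_Cauchy_ring p)"
    unfolding padic_Cauchy_iff
  proof (intro allI impI)
    fix e :: real assume e: "e > 0"
    obtain N1 where N1: "\<And>m n. m \<ge> N1 \<Longrightarrow> n \<ge> N1 \<Longrightarrow> d (\<sigma> m) (\<sigma> n) < e"
      using \<sigma> e unfolding MCauchy_def by meson
    obtain N2 where N2: "\<And>n. n \<ge> N2 \<Longrightarrow> d (\<sigma> n) (rat_emb (q n)) < e"
      using order_tendstoD(2)[OF q_lim e] by (auto simp: eventually_sequentially)
    have "padic_abs p (q m - q n) < e" if "m \<ge> max N1 N2" "n \<ge> max N1 N2" for m n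
    proof -
      have "d (rat_emb (q m)) (\<sigma> n) < e"
        using Qp_dist_ultrametric[of "rat_emb (q m)" "\<sigma> m" "\<sigma> n"] N1[of m n] N2[of m] that K
        by (simp add: commute[of "rat_emb (q m)" "\<sigma> m"])
      then have "d (rat_emb (q m)) (rat_emb (q n)) < e"
        using Qp_dist_ultrametric[of "rat_emb (q m)" "\<sigma> n" "rat_emb (q n)"] N2[of n] that K by simp
      then show ?thesis
        by (simp add: Qp_dist_rat_emb)
    qed
    then show "\<exists>N. \<forall>m\<ge>N. \<forall>n\<ge>N. padic_abs p (q m - q n) < e"
      by blast
  qed
  define x where "x = Qp_class p q"
  have x: "x \<in> K"
    using q_Cauchy by (auto simp: x_def carrier_Qp)
  have "limitin mtopology \<sigma> x sequentially"
    unfolding limitin_metric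
  proof (intro conjI allI impI x)
    fix e :: real assume e: "e > 0"
    obtain N where N: "\<And>m n. m \<ge> N \<Longrightarrow> n \<ge> N \<Longrightarrow> padic_abs p (q m - q n) < e / 2"
      using q_Cauchy e half_gt_zero unfolding padic_Cauchy_iff by meson
    have near: "d (rat_emb (q m)) x < e" if "m \<ge> N" for m
    proof -
      have "\<forall>\<^sub>F n in sequentially. padic_abs p (q m - q n) \<le> e / 2"
        using N that by (auto simp: eventually_sequentially intro!: exI[of _ N] less_imp_le)
      then have "d (rat_emb (q m)) x \<le> e / 2"
        unfolding x_def by (rule tendsto_upperbound[OF Qp_dist_tendsto[OF padic_Cauchy_const q_Cauchy]]) simp
      then show ?thesis
        using e by simp
    qed
    have "\<forall>\<^sub>F n in sequentially. d (\<sigma> n) (rat_emb (q n)) < e \<and> n \<ge> N"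
      using order_tendstoD(2)[OF q_lim e] eventually_ge_at_top[of N] by (rule eventually_conj)
    then show "\<forall>\<^sub>F n in sequentially. \<sigma> n \<in> K \<and> d (\<sigma> n) x < e"
    proof eventually_elim
      case (elim n)
      then show ?case
        using Qp_dist_ultrametric[of "\<sigma> n" "rat_emb (q n)" x] near[of n] K x
          by (auto simp: max_def split: if_splits)
    qed
  qed
  then show "\<exists>x. limitin mtopology \<sigma> x sequentially"
    by blast
qed

text \<open>After a translation, \<open>x\<close> is \<open>0\<close>. A rational number near \<open>y\<close> then has absolute value at most \<open>1\<close>, so it is
close to one of the integers below \<open>p ^ n\<close>.\<close>

lemma Qp_ball_residues:
  assumes x: "x \<in> K" and y: "y \<in> K" "d x y \<le> 1"
  shows "\<exists>a<p ^ n. d y (x \<oplus>\<^bsub>Qp p\<^esub> rat_emb (of_nat a)) \<le> (1 / real p) ^ n"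
proof -
  define z where "z = y \<ominus>\<^bsub>Qp p\<^esub> x"
  have z: "z \<in> K"
    using x y by (simp add: z_def)
  have y_eq: "y = x \<oplus>\<^bsub>Qp p\<^esub> z"
    unfolding z_def using x y by algebra
  have "d x y = d (x \<oplus>\<^bsub>Qp p\<^esub> rat_emb 0) (x \<oplus>\<^bsub>Qp p\<^esub> z)"
    using x by (simp add: y_eq rat_emb_0)
  then have z1: "d (rat_emb 0) z \<le> 1"
    using Qp_dist_translate[OF x rat_emb_closed z, of 0] y(2) by simp
  have pos: "0 < (1 / real p) ^ n" and le1: "(1 / real p) ^ n \<le> 1"
    using prime_gt_0_nat[OF prime_p] by (auto intro: power_le_one)
  obtain q where q: "d z (rat_emb q) < (1 / real p) ^ n"
    using Qp_rat_dense[OF z pos] by blast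
  have "d (rat_emb 0) (rat_emb q) \<le> 1"
    using Qp_dist_ultrametric[of "rat_emb 0" z "rat_emb q"] z z1 q le1 by simp
  then have "padic_abs p q \<le> 1"
    by (simp add: Qp_dist_rat_emb padic_abs_uminus)
  then obtain a where a: "a < p ^ n" "padic_abs p (q - of_nat a) \<le> (1 / real p) ^ n"
    using padic_abs_integer_approx[OF prime_p] by blast
  have "d z (rat_emb (of_nat a)) \<le> (1 / real p) ^ n"
    using Qp_dist_ultrametric[of z "rat_emb q" "rat_emb (of_nat a)"] z q a(2) by (simp add: Qp_dist_rat_emb)
  then show ?thesis
    using a(1) Qp_dist_translate[OF x z rat_emb_closed] by (auto simp: y_eq)
qed

section \<open>Balls\<close>

lemma one_over_prime_power: "0 < (1 / real p) ^ n" "(1 / real p) ^ n \<le> 1"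
  using prime_gt_0_nat[OF prime_p] by (auto intro: power_le_one)

lemma ex_one_over_prime_power_less: "e > 0 \<Longrightarrow> \<exists>n. (1 / real p) ^ n < e"
  using prime_gt_1_nat[OF prime_p] by (intro real_arch_pow_inv) auto

text \<open>By the ultrametric inequality, every point of a ball is a center of it, and so a center of each larger
concentric ball.\<close>

lemma Qp_ball_eq:
  assumes "y \<in> B n x" "m \<le> n"
  shows "B m y = B m x"
proof -
  have "(1 / real p) ^ n \<le> (1 / real p) ^ m"
    using assms(2) prime_gt_0_nat[OF prime_p] by (intro power_decreasing) auto
  then have xy: "x \<in> K" "y \<in> K" "d x y \<le> (1 / real p) ^ m"
    using assms(1) by auto
  then have "d x z \<le> (1 / real p) ^ m \<longleftrightarrow> d y z \<le> (1 / real p) ^ m" if "z \<in> K" for z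
    using that Qp_dist_ultrametric[of x y z] Qp_dist_ultrametric[of y x z] by (auto simp: commute[of y x])
  then show ?thesis
    using xy by auto
qed

lemma Int_stable_Qp_balls: "Int_stable (insert {} {B n x | n x. x \<in> K})"
proof -
  have main: "B m x \<inter> B n y = {} \<or> B m x \<inter> B n y = B n y" if "m \<le> n" for m n x y
  proof (rule disjCI)
    assume "B m x \<inter> B n y \<noteq> B n y"
    show "B m x \<inter> B n y = {}"
    proof (rule ccontr)
      assume "B m x \<inter> B n y \<noteq> {}"
      then obtain z where z: "z \<in> B m x" "z \<in> B n y" by blast
      have "B n y = B n z" "B m x = B m z"
        using Qp_ball_eq[OF z(2) order_refl] Qp_ball_eq[OF z(1) order_refl] by auto
      moreover have "B n z \<subseteq> B m z"
        using that prime_gt_0_nat[OF prime_p] by (intro mcball_subset_concentric power_decreasing) auto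
      ultimately show False
        using \<open>B m x \<inter> B n y \<noteq> B n y\<close> by auto
    qed
  qed
  have Int_balls: "B m x \<inter> B n y \<in> insert {} {B n x | n x. x \<in> K}" if "x \<in> K" "y \<in> K" for m n x y
    using main[of m n x y] main[of n m y x] that by (cases "m \<le> n") (auto simp: Int_commute)
  show ?thesis
  proof (rule Int_stableI)
    fix S T assume S: "S \<in> insert {} {B n x | n x. x \<in> K}" and T: "T \<in> insert {} {B n x | n x. x \<in> K}"
    show "S \<inter> T \<in> insert {} {B n x | n x. x \<in> K}"
    proof (cases "S = {} \<or> T = {}")
      case False
      then obtain m x n y where "S = B m x" "x \<in> K" "T = B n y" "y \<in> K"
        using S T by blast
      then show ?thesis
        using Int_balls by blast
    qed auto
  qed
qed

lemma Qp_ball_separated: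
  assumes "y \<in> B n x" "z \<in> K - B n x"
  shows "(1 / real p) ^ n \<le> d y z"
proof (rule ccontr)
  assume "\<not> ?thesis"
  then have "z \<in> B n y"
    using assms by auto
  then show False
    using Qp_ball_eq[OF assms(1) order_refl] assms(2) by blast
qed

lemma openin_Qp_ball: "openin mtopology (B n x)"
proof -
  have "mball y ((1 / real p) ^ n) \<subseteq> B n x" if "y \<in> B n x" for y
    using Qp_ball_separated[OF that] by force
  then show ?thesis
    unfolding openin_mtopology using one_over_prime_power(1) mcball_subset_mspace by blast
qed

text \<open>These are the residue classes modulo \<open>p ^ n\<close>, translated by \<open>x\<close>. Both compactness of balls and the value
of an invariant measure on them rest on this partition.\<close>

lemma Qp_ball_residue_partition:
  assumes x: "x \<in> K"
  shows "B 0 x = (\<Union>a<p ^ n. B n (x \<oplus>\<^bsub>Qp p\<^esub> rat_emb (of_nat a)))"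
    and "disjoint_family_on (\<lambda>a. B n (x \<oplus>\<^bsub>Qp p\<^esub> rat_emb (of_nat a))) {..<p ^ n}"
proof -
  let ?c = "\<lambda>a::nat. x \<oplus>\<^bsub>Qp p\<^esub> rat_emb (of_nat a)"
  have c: "?c a \<in> K" for a using x by simp
  have dist: "d (?c a) (?c b) = padic_abs p (of_int (int a - int b))" for a b
    using x by (simp add: Qp_dist_translate Qp_dist_rat_emb)
  have "B n (?c a) \<subseteq> B 0 x" for a
  proof -
    have "d x (?c a) = d (x \<oplus>\<^bsub>Qp p\<^esub> rat_emb 0) (?c a)"
      using x by (simp add: rat_emb_0)
    also have "\<dots> = padic_abs p (of_int (- int a))"
      using x by (simp only: Qp_dist_translate rat_emb_closed Qp_dist_rat_emb) simp
    also have "\<dots> \<le> 1"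
      using padic_abs_of_int_le_iff[OF prime_p, of "- int a" 0] by simp
    finally have "?c a \<in> B 0 x"
      using x c by simp
    then have "B 0 x = B 0 (?c a)"
      using Qp_ball_eq by blast
    then show ?thesis
      using mcball_subset_concentric[of "(1 / real p) ^ n" 1] one_over_prime_power(2) by auto
  qed
  moreover have "y \<in> (\<Union>a<p ^ n. B n (?c a))" if "y \<in> B 0 x" for y
    using Qp_ball_residues[OF x, of y n] that c by (auto simp: commute)
  ultimately show "B 0 x = (\<Union>a<p ^ n. B n (?c a))"
    by blast
  show "disjoint_family_on (\<lambda>a. B n (?c a)) {..<p ^ n}"
    unfolding disjoint_family_on_def
  proof (intro ballI impI)
    fix a b assume ab: "a \<in> {..<p ^ n}" "b \<in> {..<p ^ n}" "a \<noteq> b"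
    show "B n (?c a) \<inter> B n (?c b) = {}"
    proof (rule ccontr)
      assume "B n (?c a) \<inter> B n (?c b) \<noteq> {}"
      then obtain z where "z \<in> B n (?c a)" "z \<in> B n (?c b)" by blast
      then have "?c b \<in> B n (?c a)"
        using Qp_ball_eq[OF _ order_refl] c one_over_prime_power(1) by (metis centre_in_mcball_iff less_imp_le)
      then have "int p ^ n dvd int a - int b"
        using dist[of a b] padic_abs_of_int_le_iff[OF prime_p, of "int a - int b" n] by simp
      moreover have "\<bar>int a - int b\<bar> < int (p ^ n)"
        using ab unfolding lessThan_iff of_nat_less_iff[symmetric, where 'a=int] by linarith
      ultimately show False
        using ab(3) zdvd_imp_le[of "int (p ^ n)" "\<bar>int a - int b\<bar>"] by auto
    qed
  qed
qed

lemma compactin_Qp_ball: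
  assumes x: "x \<in> K"
  shows "compactin mtopology (B n x)"
proof -
  have "mtotally_bounded (B 0 x)"
    unfolding mtotally_bounded_def
  proof (intro allI impI)
    fix e :: real assume "e > 0"
    then obtain m where m: "(1 / real p) ^ m < e"
      using ex_one_over_prime_power_less by blast
    let ?C = "(\<lambda>a. x \<oplus>\<^bsub>Qp p\<^esub> rat_emb (of_nat a)) ` {..<p ^ m}"
    have "?C \<subseteq> B 0 x"
      unfolding Qp_ball_residue_partition(1)[OF x, of m] using x one_over_prime_power(1)[of m]
      by (auto simp: less_imp_le)
    moreover have "B 0 x \<subseteq> (\<Union>y\<in>?C. mball y e)"
      unfolding Qp_ball_residue_partition(1)[OF x, of m]
      using mcball_subset_mball_concentric[OF m] by fastforce
    ultimately show "\<exists>C. finite C \<and> C \<subseteq> B 0 x \<and> B 0 x \<subseteq> (\<Union>y\<in>C. mball y e)"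
      by blast
  qed
  moreover have "B n x \<subseteq> B 0 x"
    using mcball_subset_concentric[of "(1 / real p) ^ n" 1] one_over_prime_power(2) by auto
  ultimately have "mtotally_bounded (B n x)"
    using mtotally_bounded_subset by blast
  then show ?thesis
    using mtotally_bounded_eq_compact_closure_of[OF mcomplete_Qp] closedin_mcball closure_of_closedin
    by metis
qed

lemma Zp_eq_ball: "Zp p = B 0 (rat_emb 0)"
proof -
  have "Qp_abs p x = d (rat_emb 0) x" if "x \<in> K" for x
  proof -
    have "x \<ominus>\<^bsub>Qp p\<^esub> \<zero>\<^bsub>Qp p\<^esub> = x"
      using that by algebra
    then show ?thesis
      using that Qp_dist_eq[of x "rat_emb 0"] by (simp add: commute[of x] rat_emb_0)
  qed
  then show ?thesis
    by (auto simp: Zp_def)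
qed

text \<open>Every bounded set lies in a ball whose radius is its diameter, but that radius can be \<open>0\<close>. The slack \<open>\<eta>\<close>
makes room for a ball of positive radius. The least \<open>n\<close> with \<open>p\<^bsup>-n\<^esup> \<le> diam + \<eta>\<close> works: for \<open>n = 0\<close> because
the diameter is at most \<open>1\<close>, and otherwise because all distances within \<open>S\<close> are less than \<open>p\<^bsup>1-n\<^esup>\<close>,
hence at most \<open>p\<^bsup>-n\<^esup>\<close>.\<close>

lemma Qp_ball_enclosing:
  assumes "S \<subseteq> K" and diam: "ediam d S \<le> 1" and "\<eta> > 0"
  shows "\<exists>n x. x \<in> K \<and> S \<subseteq> B n x \<and> (1 / real p) ^ n \<le> enn2real (ediam d S) + \<eta>"
proof (cases "S = {}")
  case True
  then show ?thesis
    using ex_one_over_prime_power_less[OF \<open>\<eta> > 0\<close>] rat_emb_closed less_imp_le by simp blast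
next
  case False
  then obtain x where x: "x \<in> S" by blast
  define r where "r = enn2real (ediam d S)"
  have "ediam d S = ennreal r"
    using diam unfolding r_def by (metis ennreal_1 ennreal_enn2real ennreal_less_top order_le_less_trans)
  moreover have r0: "r \<ge> 0"
    by (simp add: r_def)
  ultimately have r: "d x y \<le> r" if "y \<in> S" for y
    using ediam_ge[OF x that, of d] by (simp add: ennreal_le_iff)
  have r1: "r \<le> 1"
    using enn2real_mono[OF diam] by (simp add: r_def)
  define n where "n = (LEAST n. (1 / real p) ^ n \<le> r + \<eta>)"
  have "\<exists>n. (1 / real p) ^ n \<le> r + \<eta>"
    using ex_one_over_prime_power_less[of "r + \<eta>"] r0 \<open>\<eta> > 0\<close> by (auto intro: less_imp_le)
  then have n: "(1 / real p) ^ n \<le> r + \<eta>"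
    unfolding n_def by (rule LeastI_ex)
  have "d x y \<le> (1 / real p) ^ n" if "y \<in> S" for y
  proof (cases n)
    case 0
    then show ?thesis using r[OF that] r1 by simp
  next
    case (Suc m)
    then have "r + \<eta> < (1 / real p) ^ m"
      using not_less_Least[of m "\<lambda>n. (1 / real p) ^ n \<le> r + \<eta>"] by (simp add: n_def not_le)
    then show ?thesis
      using Qp_dist_less_power[of x y m] r[OF that] \<open>\<eta> > 0\<close> x that \<open>S \<subseteq> K\<close> Suc by auto
  qed
  then show ?thesis
    using n x \<open>S \<subseteq> K\<close> by (intro exI[of _ n] exI[of _ x]) (auto simp: r_def)
qed

lemma ediam_Qp_ball: "ediam d (B n x) \<le> ennreal ((1 / real p) ^ n)"
proof (rule ediam_le)
  fix y z assume "y \<in> B n x" "z \<in> B n x"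
  then show "d y z \<le> (1 / real p) ^ n"
    using Qp_ball_eq[where y=y and x=x and n=n and m=n] by auto
qed

section \<open>The one-dimensional Hausdorff measure on Borel sets\<close>

abbreviation h :: "(nat \<Rightarrow> rat) set set \<Rightarrow> ennreal" where "h \<equiv> hausdorff_measure K d 1"

abbreviation balls :: "(nat \<Rightarrow> rat) set set set" where "balls \<equiv> insert {} {B n x | n x. x \<in> K}"

lemma diam_powr_one: "diam_powr d 1 S = ennreal (enn2real (ediam d S))"
  by (simp add: diam_powr_def)

text \<open>Balls centered at rational numbers suffice, and there are countably many of them.\<close>

lemma Qp_open_eq_Union_balls:
  assumes U: "openin mtopology U"
  obtains C :: "nat \<Rightarrow> (nat \<Rightarrow> rat) set set" where "U = (\<Union>i. C i)" "\<And>i. C i \<in> balls"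
proof -
  \<comment> \<open>Pairs \<open>(n, q)\<close> are enumerated through \<open>from_nat\<close>; those whose ball sticks out of \<open>U\<close> contribute nothing.\<close>
  define D where "D = (\<lambda>(n, q). if B n (rat_emb q) \<subseteq> U then B n (rat_emb q) else {})"
  have "x \<in> (\<Union>i. D (from_nat i))" if x: "x \<in> U" for x
  proof -
    obtain r where r: "r > 0" "mball x r \<subseteq> U" and xK: "x \<in> K"
      using U x unfolding openin_mtopology by blast
    obtain n where n: "(1 / real p) ^ n < r"
      using ex_one_over_prime_power_less[OF r(1)] by blast
    obtain q where q: "d x (rat_emb q) < (1 / real p) ^ n"
      using Qp_rat_dense[OF xK one_over_prime_power(1)] by blast
    have xq: "x \<in> B n (rat_emb q)"
      using q xK by (simp add: commute)
    then have "B n (rat_emb q) = B n x"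
      using Qp_ball_eq[OF xq order_refl] by simp
    then have "B n (rat_emb q) \<subseteq> U"
      using mcball_subset_mball_concentric[OF n] r(2) by blast
    then have "x \<in> D (from_nat (to_nat (n, q)))"
      using xq by (simp add: D_def)
    then show ?thesis
      by blast
  qed
  moreover have "D nq \<subseteq> U" for nq
    by (auto simp: D_def split: prod.split)
  moreover have "D nq \<in> balls" for nq
  proof (cases nq)
    case (Pair n q)
    show ?thesis
    proof (cases "B n (rat_emb q) \<subseteq> U")
      case True
      then have "D nq = B n (rat_emb q)"
        by (simp add: D_def Pair)
      then show ?thesis
        using rat_emb_closed by blast
    qed (simp add: D_def Pair)
  qed
  ultimately show ?thesis
    by (intro that[of "\<lambda>i. D (from_nat i)"]) blast+
qed

lemma balls_subset_Pow: "balls \<subseteq> Pow K"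
  using mcball_subset_mspace by auto

lemma openin_balls: "S \<in> balls \<Longrightarrow> openin mtopology S"
  using openin_Qp_ball by auto

lemma compactin_balls: "S \<in> balls \<Longrightarrow> compactin mtopology S"
  using compactin_Qp_ball by auto

lemma sets_borel_Qp: "sets (borel_of (Qp_topology p)) = sigma_sets K balls"
proof -
  have "{U. openin mtopology U} \<subseteq> Pow K"
    using openin_subset[of mtopology] by auto
  then have "sets (borel_of (Qp_topology p)) = sigma_sets K {U. openin mtopology U}"
    unfolding borel_of_def Qp_topology_def topspace_mtopology by (rule sets_measure_of)
  also have "\<dots> = sigma_sets K balls"
  proof (rule sigma_sets_eqI)
    fix U assume "U \<in> {U. openin mtopology U}"
    then obtain C :: "nat \<Rightarrow> _" where "U = (\<Union>i. C i)" "\<And>i. C i \<in> balls"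
      using Qp_open_eq_Union_balls by blast
    then show "U \<in> sigma_sets K balls"
      by (simp only:) (intro sigma_sets.Union sigma_sets.Basic)
  next
    fix S assume "S \<in> balls"
    then show "S \<in> sigma_sets K {U. openin mtopology U}"
      by (intro sigma_sets.Basic CollectI openin_balls)
  qed
  finally show ?thesis .
qed

definition hausdorff_borel :: "(nat \<Rightarrow> rat) set measure" where
  "hausdorff_borel = measure_of K balls h"

lemma space_hausdorff_borel [simp]: "space hausdorff_borel = K"
  unfolding hausdorff_borel_def using balls_subset_Pow by (rule space_measure_of)

lemma sets_hausdorff_borel: "sets hausdorff_borel = sigma_sets K balls"
  unfolding hausdorff_borel_def using balls_subset_Pow by (rule sets_measure_of)

lemma emeasure_hausdorff_borel:
  assumes "A \<in> sets hausdorff_borel"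
  shows "emeasure hausdorff_borel A = h A"
proof -
  have "measure_space K (sigma_sets K balls) h"
  proof (rule measure_space_hausdorff)
    fix S assume "S \<in> balls"
    then consider "S = {}" | n x where "S = B n x"
      by blast
    then show "S \<subseteq> K \<and> (\<exists>r>0. \<forall>x\<in>S. \<forall>y\<in>K - S. r \<le> d x y)"
    proof cases
      case 1
      then show ?thesis
        by (simp add: exI[of _ 1])
    next
      case 2
      then show ?thesis
        using Qp_ball_separated[of _ x n] one_over_prime_power(1)[of n] mcball_subset_mspace[of x "(1 / real p) ^ n"]
        by (intro conjI exI[of _ "(1 / real p) ^ n"]) simp_all
    qed
  qed
  then show ?thesis
    using emeasure_measure_of[OF hausdorff_borel_def balls_subset_Pow _ _ assms]
    by (simp add: measure_space_def sets_hausdorff_borel)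
qed

lemma Qp_translate_ball:
  assumes g: "g \<in> K" and x: "x \<in> K"
  shows "(\<lambda>y. g \<oplus>\<^bsub>Qp p\<^esub> y) ` B n x = B n (g \<oplus>\<^bsub>Qp p\<^esub> x)"
proof (intro equalityI subsetI)
  fix z assume z: "z \<in> B n (g \<oplus>\<^bsub>Qp p\<^esub> x)"
  define y where "y = z \<ominus>\<^bsub>Qp p\<^esub> g"
  have zK: "z \<in> K" and y: "y \<in> K"
    using z g by (auto simp: y_def)
  have "z = g \<oplus>\<^bsub>Qp p\<^esub> y"
    unfolding y_def using zK g by algebra
  moreover have "y \<in> B n x"
    using z x y g unfolding \<open>z = g \<oplus>\<^bsub>Qp p\<^esub> y\<close> by (simp add: Qp_dist_translate)
  ultimately show "z \<in> (\<lambda>y. g \<oplus>\<^bsub>Qp p\<^esub> y) ` B n x"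
    by blast
qed (use g x in \<open>auto simp: Qp_dist_translate\<close>)

lemma hausdorff_Qp_translate:
  assumes g: "g \<in> K" and A: "A \<subseteq> K"
  shows "h ((\<lambda>y. g \<oplus>\<^bsub>Qp p\<^esub> y) ` A) = h A"
proof (rule antisym)
  have le: "h ((\<lambda>y. g \<oplus>\<^bsub>Qp p\<^esub> y) ` A) \<le> h A" if "g \<in> K" "A \<subseteq> K" for g A
    using that by (intro hausdorff_measure_isometry_le) (auto simp: Qp_dist_translate)
  show "h ((\<lambda>y. g \<oplus>\<^bsub>Qp p\<^esub> y) ` A) \<le> h A"
    by (rule le[OF g A])
  have "\<ominus>\<^bsub>Qp p\<^esub> g \<oplus>\<^bsub>Qp p\<^esub> (g \<oplus>\<^bsub>Qp p\<^esub> y) = y" if "y \<in> A" for y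
    using g A that by (intro Qp.r_neg1) auto
  then have "(\<lambda>y. \<ominus>\<^bsub>Qp p\<^esub> g \<oplus>\<^bsub>Qp p\<^esub> y) ` (\<lambda>y. g \<oplus>\<^bsub>Qp p\<^esub> y) ` A = A"
    by (simp add: image_image cong: image_cong)
  then show "h A \<le> h ((\<lambda>y. g \<oplus>\<^bsub>Qp p\<^esub> y) ` A)"
    using le[of "\<ominus>\<^bsub>Qp p\<^esub> g" "(\<lambda>y. g \<oplus>\<^bsub>Qp p\<^esub> y) ` A"] g A by auto
qed

text \<open>The covering sets are replaced by enclosing balls, where the \<open>i\<close>-th set may grow by \<open>e / 2 ^ Suc i\<close>.\<close>

lemma Qp_ball_cover:
  assumes S: "admissible_cover K d 1 A S" and "e > 0"
  obtains n x where "\<And>i. x i \<in> K" "A \<subseteq> (\<Union>i. B (n i) (x i))"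
    "(\<Sum>i. ennreal ((1 / real p) ^ n i)) \<le> (\<Sum>i. diam_powr d 1 (S i)) + ennreal e"
proof -
  have "\<exists>n x. x \<in> K \<and> S i \<subseteq> B n x \<and> (1 / real p) ^ n \<le> enn2real (ediam d (S i)) + e * (1/2) ^ Suc i" for i
    using S \<open>e > 0\<close> by (intro Qp_ball_enclosing) (auto simp: admissible_cover_def)
  then obtain n x where nx: "\<And>i. x i \<in> K" "\<And>i. S i \<subseteq> B (n i) (x i)"
      "\<And>i. (1 / real p) ^ n i \<le> enn2real (ediam d (S i)) + e * (1/2) ^ Suc i"
    by metis
  have "A \<subseteq> (\<Union>i. B (n i) (x i))"
    using S nx(2) unfolding admissible_cover_def by blast
  moreover have "(\<Sum>i. ennreal ((1 / real p) ^ n i)) \<le> (\<Sum>i. diam_powr d 1 (S i)) + ennreal e"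
  proof -
    have "(\<Sum>i. ennreal ((1 / real p) ^ n i)) \<le> (\<Sum>i. diam_powr d 1 (S i) + ennreal e * ennreal ((1/2) ^ Suc i))"
    proof (intro suminf_le allI)
      fix i
      have "ennreal ((1 / real p) ^ n i) \<le> ennreal (enn2real (ediam d (S i)) + e * (1/2) ^ Suc i)"
        by (intro ennreal_leI nx(3))
      also have "\<dots> = diam_powr d 1 (S i) + ennreal e * ennreal ((1/2) ^ Suc i)"
        using \<open>e > 0\<close> by (subst ennreal_plus) (auto simp: diam_powr_one ennreal_mult[symmetric])
      finally show "ennreal ((1 / real p) ^ n i) \<le> diam_powr d 1 (S i) + ennreal e * ennreal ((1/2) ^ Suc i)" .
    qed auto
    also have "\<dots> = (\<Sum>i. diam_powr d 1 (S i)) + (\<Sum>i. ennreal e * ennreal ((1/2) ^ Suc i))"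
      by (subst suminf_add[symmetric]) auto
    also have "\<dots> = (\<Sum>i. diam_powr d 1 (S i)) + ennreal e"
      unfolding ennreal_suminf_cmult
      by (subst suminf_ennreal_eq[OF zero_le_power power_half_series]) auto
    finally show ?thesis .
  qed
  ultimately show ?thesis
    using that nx(1) by blast
qed

section \<open>Normalization\<close>

lemma hausdorff_Zp_le: "h (B 0 (rat_emb 0)) \<le> 1"
proof (rule hausdorff_measure_least)
  fix \<epsilon> :: real assume "\<epsilon> > 0"
  then obtain n where n: "(1 / real p) ^ n < \<epsilon>"
    using ex_one_over_prime_power_less by blast
  define S where "S i = (if i < p ^ n then B n (\<zero>\<^bsub>Qp p\<^esub> \<oplus>\<^bsub>Qp p\<^esub> rat_emb (of_nat i)) else {})" for i
  have diam: "ediam d (S i) \<le> ennreal ((1 / real p) ^ n)" for i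
    using ediam_Qp_ball by (simp add: S_def)
  have "admissible_cover K d \<epsilon> (B 0 (rat_emb 0)) S"
    unfolding admissible_cover_def
  proof (intro conjI allI)
    show "B 0 (rat_emb 0) \<subseteq> (\<Union>i. S i)"
      unfolding rat_emb_0 Qp_ball_residue_partition(1)[OF Qp.zero_closed, of n] by (auto simp: S_def)
    show "S i \<subseteq> K" for i
      by (auto simp: S_def)
    show "ediam d (S i) \<le> ennreal \<epsilon>" for i
      using diam[of i] ennreal_leI[of "(1 / real p) ^ n" \<epsilon>] n by (meson less_imp_le order_trans)
  qed
  then have "hausdorff_premeasure K d 1 \<epsilon> (B 0 (rat_emb 0)) \<le> (\<Sum>i. diam_powr d 1 (S i))"
    by (rule hausdorff_premeasure_le)
  also have "\<dots> = (\<Sum>i<p ^ n. diam_powr d 1 (S i))"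
    by (rule suminf_finite) (auto simp: S_def)
  also have "\<dots> \<le> (\<Sum>i<p ^ n. ennreal ((1 / real p) ^ n))"
  proof (rule sum_mono)
    fix i
    show "diam_powr d 1 (S i) \<le> ennreal ((1 / real p) ^ n)"
      using enn2real_mono[OF diam[of i]] one_over_prime_power(1)[of n]
      by (auto simp: diam_powr_one intro!: ennreal_leI)
  qed
  also have "\<dots> = ennreal (real (p ^ n) * (1 / real p) ^ n)"
    by (simp add: ennreal_of_nat_eq_real_of_nat ennreal_mult[symmetric] one_over_prime_power(1) less_imp_le)
  also have "\<dots> = 1"
    using prime_gt_0_nat[OF prime_p] by (simp add: power_one_over)
  finally show "hausdorff_premeasure K d 1 \<epsilon> (B 0 (rat_emb 0)) \<le> 1" .
qed

text \<open>For \<open>N\<close> at least as large as all \<open>n i\<close>, the \<open>i\<close>-th ball contains at most \<open>p ^ (N - n i)\<close> of the integers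
below \<open>p ^ N\<close>, since any two of those in the ball are congruent modulo \<open>p ^ n i\<close>. All \<open>p ^ N\<close> integers are
covered, so dividing by \<open>p ^ N\<close> gives the bound.\<close>

lemma Zp_finite_ball_cover:
  assumes "finite I" and cover: "B 0 (rat_emb 0) \<subseteq> (\<Union>i\<in>I. B (n i) (x i))"
  shows "1 \<le> (\<Sum>i\<in>I. (1 / real p) ^ n i)"
proof -
  define N where "N = sum n I"
  have nN: "n i \<le> N" if "i \<in> I" for i
    unfolding N_def using that \<open>finite I\<close> by (intro member_le_sum) auto
  define F where "F i = {a. a < p ^ N \<and> rat_emb (of_nat a) \<in> B (n i) (x i)}" for i
  have fin: "finite (F i)" for i
    by (simp add: F_def)
  have "{..<p ^ N} \<subseteq> (\<Union>i\<in>I. F i)"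
  proof
    fix a assume a: "a \<in> {..<p ^ N}"
    have "padic_abs p (0 - of_nat a) \<le> 1"
      using padic_abs_of_int_le_iff[OF prime_p, of "- int a" 0] by simp
    then have "rat_emb (of_nat a) \<in> B 0 (rat_emb 0)"
      by (simp add: Qp_dist_rat_emb)
    then obtain i where "i \<in> I" "rat_emb (of_nat a) \<in> B (n i) (x i)"
      using cover by blast
    then show "a \<in> (\<Union>i\<in>I. F i)"
      using a unfolding F_def by blast
  qed
  then have "p ^ N \<le> card (\<Union>i\<in>I. F i)"
    using card_mono[of "\<Union>i\<in>I. F i" "{..<p ^ N}"] \<open>finite I\<close> fin by simp
  also have "\<dots> \<le> (\<Sum>i\<in>I. card (F i))"
    by (rule card_UN_le[OF \<open>finite I\<close>])
  also have "\<dots> \<le> (\<Sum>i\<in>I. p ^ (N - n i))"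
  proof (rule sum_mono)
    fix i assume i: "i \<in> I"
    show "card (F i) \<le> p ^ (N - n i)"
    proof (rule card_congruent_le)
      fix a b assume ab: "a \<in> F i" "b \<in> F i"
      have "rat_emb (of_nat b) \<in> B (n i) (rat_emb (of_nat a))"
        using ab Qp_ball_eq[OF _ order_refl] unfolding F_def by blast
      then have "padic_abs p (of_int (int a - int b)) \<le> (1 / real p) ^ n i"
        by (simp add: Qp_dist_rat_emb)
      then show "int p ^ n i dvd int a - int b"
        by (simp only: padic_abs_of_int_le_iff[OF prime_p])
    qed (use nN[OF i] prime_gt_0_nat[OF prime_p] in \<open>auto simp: F_def\<close>)
  qed
  finally have "real (p ^ N) \<le> real (\<Sum>i\<in>I. p ^ (N - n i))"
    by (simp only: of_nat_le_iff)
  also have "\<dots> = (\<Sum>i\<in>I. real p ^ N * (1 / real p) ^ n i)"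
    unfolding of_nat_sum
  proof (rule sum.cong)
    fix i assume "i \<in> I"
    then have "real p ^ N = real p ^ (N - n i) * real p ^ n i"
      using nN by (simp flip: power_add)
    then show "real (p ^ (N - n i)) = real p ^ N * (1 / real p) ^ n i"
      using prime_gt_0_nat[OF prime_p] by (simp add: power_one_over)
  qed simp
  finally show ?thesis
    using prime_gt_0_nat[OF prime_p] by (simp add: sum_distrib_left[symmetric])
qed

text \<open>It is enough to bound the premeasure at scale \<open>1\<close>. Balls are open, so compactness of \<open>Zp p\<close> reduces a
countable cover by balls to a finite one.\<close>

lemma hausdorff_Zp_ge: "1 \<le> h (B 0 (rat_emb 0))"
proof -
  have "1 \<le> hausdorff_premeasure K d 1 1 (B 0 (rat_emb 0))"
  proof (rule hausdorff_premeasure_greatest)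
    fix S assume S: "admissible_cover K d 1 (B 0 (rat_emb 0)) S"
    show "1 \<le> (\<Sum>i. diam_powr d 1 (S i))"
    proof (rule ennreal_le_epsilon)
      fix e :: real assume "e > 0"
      obtain n x where nx: "\<And>i. x i \<in> K" "B 0 (rat_emb 0) \<subseteq> (\<Union>i. B (n i) (x i))"
        "(\<Sum>i. ennreal ((1 / real p) ^ n i)) \<le> (\<Sum>i. diam_powr d 1 (S i)) + ennreal e"
        by (rule Qp_ball_cover[OF S \<open>e > 0\<close>]) (rule that)
      have op: "openin mtopology V" if "V \<in> range (\<lambda>i. B (n i) (x i))" for V
        using that openin_Qp_ball by (elim rangeE) (simp only:)
      obtain \<F> where \<F>: "finite \<F>" "\<F> \<subseteq> range (\<lambda>i. B (n i) (x i))" "B 0 (rat_emb 0) \<subseteq> \<Union>\<F>"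
      proof -
        have "\<exists>\<F>. finite \<F> \<and> \<F> \<subseteq> range (\<lambda>i. B (n i) (x i)) \<and> B 0 (rat_emb 0) \<subseteq> \<Union>\<F>"
          by (rule compactinD[OF compactin_Qp_ball[OF rat_emb_closed] _ nx(2)]) (rule op)
        then show ?thesis
          by (elim exE conjE) (rule that)
      qed
      obtain I where I: "finite I" "\<F> = (\<lambda>i. B (n i) (x i)) ` I"
        using finite_subset_image[OF \<F>(1,2)] by (elim exE conjE) (rule that)
      have "1 \<le> ennreal (\<Sum>i\<in>I. (1 / real p) ^ n i)"
        using Zp_finite_ball_cover[OF I(1) \<F>(3)[unfolded I(2)]] by simp
      also have "\<dots> = (\<Sum>i\<in>I. ennreal ((1 / real p) ^ n i))"
        by (intro sum_ennreal[symmetric]) (simp add: one_over_prime_power(1) less_imp_le)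
      also have "\<dots> \<le> (\<Sum>i. ennreal ((1 / real p) ^ n i))"
        using I(1) by (intro sum_le_suminf) auto
      finally show "1 \<le> (\<Sum>i. diam_powr d 1 (S i)) + ennreal e"
        using nx(3) by (rule order_trans)
    qed
  qed
  then show ?thesis
    using hausdorff_premeasure_le_measure[of 1 K d 1] order_trans by fastforce
qed

lemma hausdorff_Zp: "h (B 0 (rat_emb 0)) = 1"
  using hausdorff_Zp_le hausdorff_Zp_ge by (rule antisym)

section \<open>Existence and uniqueness of the Haar measure\<close>

lemma ball_in_sets:
  assumes "sets \<mu> = sigma_sets K balls" "x \<in> K"
  shows "B n x \<in> sets \<mu>"
  using assms by (auto intro!: sigma_sets.Basic)

text \<open>The unit ball is the disjoint union of \<open>p ^ n\<close> translates of a ball of radius \<open>p\<^bsup>-n\<^esup>\<close>, so each of these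
receives the fraction \<open>1 / p ^ n\<close> of the mass. The lemma serves the Hausdorff measure as well as an
arbitrary standard Haar measure.\<close>

lemma invariant_measure_ball:
  assumes sets: "sets \<mu> = sigma_sets K balls"
    and inv: "\<And>g A. g \<in> K \<Longrightarrow> A \<in> sets \<mu> \<Longrightarrow> emeasure \<mu> ((\<lambda>y. g \<oplus>\<^bsub>Qp p\<^esub> y) ` A) = emeasure \<mu> A"
    and one: "emeasure \<mu> (B 0 (rat_emb 0)) = 1" and x: "x \<in> K"
  shows "emeasure \<mu> (B n x) = ennreal ((1 / real p) ^ n)"
proof -
  have ball: "emeasure \<mu> (B n x) = emeasure \<mu> (B n \<zero>\<^bsub>Qp p\<^esub>)" if "x \<in> K" for n x
    using inv[OF that ball_in_sets[OF sets Qp.zero_closed], of n] Qp_translate_ball[OF that Qp.zero_closed, of n] that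
    by simp
  let ?c = "\<lambda>a::nat. \<zero>\<^bsub>Qp p\<^esub> \<oplus>\<^bsub>Qp p\<^esub> rat_emb (of_nat a)"
  have c: "?c a \<in> K" for a
    by (intro Qp.add.m_closed Qp.zero_closed rat_emb_closed)
  have "1 = emeasure \<mu> (\<Union>a<p ^ n. B n (?c a))"
    using one unfolding rat_emb_0 Qp_ball_residue_partition(1)[OF Qp.zero_closed, of n] by simp
  also have "\<dots> = (\<Sum>a<p ^ n. emeasure \<mu> (B n (?c a)))"
    using ball_in_sets[OF sets c] Qp_ball_residue_partition(2)[OF Qp.zero_closed]
    by (intro sum_emeasure[symmetric]) auto
  also have "\<dots> = of_nat (p ^ n) * emeasure \<mu> (B n x)"
    by (simp only: ball[OF c] ball[OF x] sum_constant card_lessThan)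
  finally have eq: "of_nat (p ^ n) * emeasure \<mu> (B n x) = 1" ..
  have pn: "real p ^ n > 0"
    using prime_gt_0_nat[OF prime_p] by simp
  show ?thesis
  proof (cases "emeasure \<mu> (B n x)")
    case (real r)
    then have "ennreal (real p ^ n * r) = ennreal 1"
      using eq by (simp add: ennreal_of_nat_eq_real_of_nat ennreal_mult flip: ennreal_power)
    then have "real p ^ n * r = 1"
      using real pn by (subst (asm) ennreal_inj) auto
    then have "r = (1 / real p) ^ n"
      using pn by (simp add: power_one_over field_simps)
    then show ?thesis
      using real by simp
  next
    case top
    then show ?thesis
      using eq prime_gt_0_nat[OF prime_p] by (simp add: ennreal_mult_top)
  qed
qed

lemma translate_in_sets:
  assumes "g \<in> K" "A \<in> sigma_sets K balls"
  shows "(\<lambda>y. g \<oplus>\<^bsub>Qp p\<^esub> y) ` A \<in> sigma_sets K balls"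
  using assms(2)
proof induction
  case (Basic S)
  then consider "S = {}" | n x where "S = B n x" "x \<in> K"
    by blast
  then show ?case
  proof cases
    case 2
    then have "(\<lambda>y. g \<oplus>\<^bsub>Qp p\<^esub> y) ` S = B n (g \<oplus>\<^bsub>Qp p\<^esub> x)" "g \<oplus>\<^bsub>Qp p\<^esub> x \<in> K"
      using assms(1) Qp_translate_ball by auto
    then show ?thesis
      by (intro sigma_sets.Basic) blast
  qed (simp add: sigma_sets.Empty)
next
  case (Compl A)
  have inj: "inj_on (\<lambda>y. g \<oplus>\<^bsub>Qp p\<^esub> y) K"
    by (rule inj_on_inverseI[of _ "\<lambda>y. \<ominus>\<^bsub>Qp p\<^esub> g \<oplus>\<^bsub>Qp p\<^esub> y"]) (simp add: assms(1) Qp.r_neg1)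
  have "z \<in> (\<lambda>y. g \<oplus>\<^bsub>Qp p\<^esub> y) ` K" if "z \<in> K" for z
    using that assms(1) by (intro image_eqI[of _ _ "\<ominus>\<^bsub>Qp p\<^esub> g \<oplus>\<^bsub>Qp p\<^esub> z"]) (simp_all add: Qp.r_neg2)
  then have "(\<lambda>y. g \<oplus>\<^bsub>Qp p\<^esub> y) ` K = K"
    using assms(1) by auto
  moreover have "A \<subseteq> K"
    by (rule sigma_sets_into_sp[OF balls_subset_Pow Compl.hyps])
  ultimately have "(\<lambda>y. g \<oplus>\<^bsub>Qp p\<^esub> y) ` (K - A) = K - (\<lambda>y. g \<oplus>\<^bsub>Qp p\<^esub> y) ` A"
    using inj by (simp add: inj_on_image_set_diff[OF inj])
  then show ?case
    using sigma_sets.Compl[OF Compl.IH] by simp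
next
  case (Union A)
  show ?case
    unfolding image_UN by (rule sigma_sets.Union) (rule Union.IH)
qed (simp add: sigma_sets.Empty)

lemma hausdorff_borel_translate:
  assumes "g \<in> K" "A \<in> sets hausdorff_borel"
  shows "emeasure hausdorff_borel ((\<lambda>y. g \<oplus>\<^bsub>Qp p\<^esub> y) ` A) = emeasure hausdorff_borel A"
proof -
  have "A \<subseteq> K"
    using sets.sets_into_space[OF assms(2)] by simp
  then show ?thesis
    using assms translate_in_sets[OF assms(1)] hausdorff_Qp_translate[OF assms(1)]
    by (simp add: emeasure_hausdorff_borel sets_hausdorff_borel)
qed

lemma emeasure_hausdorff_borel_ball:
  "x \<in> K \<Longrightarrow> emeasure hausdorff_borel (B n x) = ennreal ((1 / real p) ^ n)"
proof (rule invariant_measure_ball[OF sets_hausdorff_borel hausdorff_borel_translate])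
  show "emeasure hausdorff_borel (B 0 (rat_emb 0)) = 1"
    unfolding emeasure_hausdorff_borel[OF ball_in_sets[OF sets_hausdorff_borel rat_emb_closed]]
    by (rule hausdorff_Zp)
qed

lemma hausdorff_ball: "x \<in> K \<Longrightarrow> h (B n x) = ennreal ((1 / real p) ^ n)"
  by (subst emeasure_hausdorff_borel[OF ball_in_sets[OF sets_hausdorff_borel], symmetric])
    (simp_all only: emeasure_hausdorff_borel_ball)

lemma openin_in_sets:
  assumes "openin mtopology U"
  shows "U \<in> sets hausdorff_borel"
proof -
  obtain C :: "nat \<Rightarrow> _" where "U = (\<Union>i. C i)" "\<And>i. C i \<in> balls"
    by (rule Qp_open_eq_Union_balls[OF assms]) (rule that)
  then show ?thesis
    unfolding sets_hausdorff_borel by (simp only:) (intro sigma_sets.Union sigma_sets.Basic)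
qed

lemma compactin_emeasure_finite:
  assumes "compactin mtopology C"
  shows "emeasure hausdorff_borel C < \<infinity>"
proof -
  have op: "openin mtopology V" if "V \<in> (\<lambda>x. B 0 x) ` C" for V
    using that openin_Qp_ball by (elim imageE) (simp only:)
  have CK: "C \<subseteq> K"
    using compactin_subset_topspace[OF assms] by simp
  have "C \<subseteq> \<Union>((\<lambda>x. B 0 x) ` C)"
    using CK by auto
  then obtain \<F> where \<F>: "finite \<F>" "\<F> \<subseteq> (\<lambda>x. B 0 x) ` C" "C \<subseteq> \<Union>\<F>"
  proof -
    have "\<exists>\<F>. finite \<F> \<and> \<F> \<subseteq> (\<lambda>x. B 0 x) ` C \<and> C \<subseteq> \<Union>\<F>"
      by (rule compactinD[OF assms _ \<open>C \<subseteq> \<Union>((\<lambda>x. B 0 x) ` C)\<close>]) (rule op)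
    then show ?thesis
      by (elim exE conjE) (rule that)
  qed
  have V: "V \<in> sets hausdorff_borel \<and> emeasure hausdorff_borel V < \<infinity>" if VF: "V \<in> \<F>" for V
  proof -
    obtain x where x: "x \<in> C" "V = B 0 x"
      using subsetD[OF \<F>(2) VF] by (elim imageE) (rule that)
    then have "x \<in> K"
      using CK by blast
    then show ?thesis
      unfolding x(2) emeasure_hausdorff_borel_ball[OF \<open>x \<in> K\<close>]
      using ball_in_sets[OF sets_hausdorff_borel \<open>x \<in> K\<close>, of 0] by (simp del: power_0)
  qed
  have "emeasure hausdorff_borel C \<le> emeasure hausdorff_borel (\<Union>V\<in>\<F>. V)"
    using \<F> V by (intro emeasure_mono sets.finite_UN) auto
  also have "\<dots> \<le> (\<Sum>V\<in>\<F>. emeasure hausdorff_borel V)"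
    using \<F> V by (intro emeasure_subadditive_finite) auto
  also have "\<dots> < \<infinity>"
    using V \<F>(1) by (simp add: less_top[symmetric])
  finally show ?thesis .
qed

text \<open>The union of an economical ball cover of \<open>A\<close> is an open set whose measure is at most the sum of the radii.\<close>

lemma hausdorff_borel_outer_regular:
  assumes A: "A \<in> sets hausdorff_borel"
  shows "emeasure hausdorff_borel A = (INF U\<in>{U. openin mtopology U \<and> A \<subseteq> U}. emeasure hausdorff_borel U)"
proof (rule antisym)
  show "emeasure hausdorff_borel A \<le> (INF U\<in>{U. openin mtopology U \<and> A \<subseteq> U}. emeasure hausdorff_borel U)"
    by (intro INF_greatest emeasure_mono) (auto intro: openin_in_sets)
  show "(INF U\<in>{U. openin mtopology U \<and> A \<subseteq> U}. emeasure hausdorff_borel U) \<le> emeasure hausdorff_borel A"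
  proof (rule ennreal_le_epsilon)
    fix e :: real assume e: "e > 0" and fin: "emeasure hausdorff_borel A < Orderings.top"
    have "hausdorff_premeasure K d 1 1 A \<le> emeasure hausdorff_borel A"
      using hausdorff_premeasure_le_measure[of 1] by (simp add: emeasure_hausdorff_borel[OF A])
    also have "\<dots> < emeasure hausdorff_borel A + ennreal (e / 2)"
      using e fin by (auto simp: less_top)
    finally obtain S where S: "admissible_cover K d 1 A S"
        "(\<Sum>i. diam_powr d 1 (S i)) < emeasure hausdorff_borel A + ennreal (e / 2)"
      by (rule hausdorff_premeasure_lessE)
    obtain n x where nx: "\<And>i. x i \<in> K" "A \<subseteq> (\<Union>i. B (n i) (x i))"
      "(\<Sum>i. ennreal ((1 / real p) ^ n i)) \<le> (\<Sum>i. diam_powr d 1 (S i)) + ennreal (e / 2)"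
      by (rule Qp_ball_cover[OF S(1) half_gt_zero[OF e]]) (rule that)
    have "openin mtopology (\<Union>i. B (n i) (x i))"
      using openin_Qp_ball by (intro openin_Union) blast
    then have "(INF U\<in>{U. openin mtopology U \<and> A \<subseteq> U}. emeasure hausdorff_borel U)
        \<le> emeasure hausdorff_borel (\<Union>i. B (n i) (x i))"
      using nx(2) by (intro INF_lower) blast
    also have "\<dots> \<le> (\<Sum>i. emeasure hausdorff_borel (B (n i) (x i)))"
      using ball_in_sets[OF sets_hausdorff_borel nx(1)] by (intro emeasure_subadditive_countably) blast
    also have "\<dots> = (\<Sum>i. ennreal ((1 / real p) ^ n i))"
      using nx(1) by (simp only: emeasure_hausdorff_borel_ball)
    also have "\<dots> \<le> (\<Sum>i. diam_powr d 1 (S i)) + ennreal (e / 2)"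
      by (rule nx(3))
    also have "\<dots> \<le> (emeasure hausdorff_borel A + ennreal (e / 2)) + ennreal (e / 2)"
      using S(2) by (intro add_right_mono less_imp_le)
    also have "\<dots> = emeasure hausdorff_borel A + ennreal e"
      using e by (simp add: add.assoc ennreal_plus[symmetric] del: ennreal_plus)
    finally show "(INF U\<in>{U. openin mtopology U \<and> A \<subseteq> U}. emeasure hausdorff_borel U)
        \<le> emeasure hausdorff_borel A + ennreal e" .
  qed
qed

text \<open>An open set is exhausted by finite unions of balls, and these are compact.\<close>

lemma hausdorff_borel_inner_regular:
  assumes U: "openin mtopology U"
  shows "emeasure hausdorff_borel U = (SUP C\<in>{C. compactin mtopology C \<and> C \<subseteq> U}. emeasure hausdorff_borel C)"
proof (rule antisym)
  show "(SUP C\<in>{C. compactin mtopology C \<and> C \<subseteq> U}. emeasure hausdorff_borel C) \<le> emeasure hausdorff_borel U"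
    by (intro SUP_least emeasure_mono openin_in_sets U) auto
  obtain C :: "nat \<Rightarrow> _" where C: "U = (\<Union>i. C i)" "\<And>i. C i \<in> balls"
    by (rule Qp_open_eq_Union_balls[OF U]) (rule that)
  define D where "D j = (\<Union>i\<le>j. C i)" for j
  have D: "U = (\<Union>j. D j)" "incseq D"
    unfolding C(1) D_def incseq_def by (blast, intro allI impI UN_mono) auto
  have sets: "D j \<in> sets hausdorff_borel" for j
    unfolding D_def using C(2) openin_balls by (intro sets.finite_UN openin_in_sets) auto
  have "compactin mtopology (D j)" for j
    unfolding D_def using C(2) compactin_balls by (intro compactin_Union) auto
  moreover have "emeasure hausdorff_borel U = (SUP j. emeasure hausdorff_borel (D j))"
    unfolding D(1) using sets by (intro SUP_emeasure_incseq[OF _ D(2), symmetric]) auto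
  ultimately show "emeasure hausdorff_borel U \<le> (SUP C\<in>{C. compactin mtopology C \<and> C \<subseteq> U}. emeasure hausdorff_borel C)"
    using D(1) by (auto intro!: SUP_mono)
qed

lemma standard_haar_hausdorff_borel: "standard_Qp_haar p hausdorff_borel"
proof -
  have one: "emeasure hausdorff_borel (B 0 (rat_emb 0)) = 1"
    using emeasure_hausdorff_borel_ball[OF rat_emb_closed, of 0 0] by simp
  have "emeasure hausdorff_borel (B 0 (rat_emb 0)) \<le> emeasure hausdorff_borel K"
    using mcball_subset_mspace openin_in_sets[OF open_in_mspace] by (intro emeasure_mono) auto
  then have "emeasure hausdorff_borel K \<noteq> 0"
    using one by auto
  then show ?thesis
    unfolding standard_Qp_haar_def haar_measure_def Zp_eq_ball Qp_topology_def
    using sets_borel_Qp[unfolded Qp_topology_def] hausdorff_borel_translate compactin_emeasure_finite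
      hausdorff_borel_outer_regular hausdorff_borel_inner_regular one sets_hausdorff_borel
    by simp
qed

lemma countable_unit_ball_cover: "K = (\<Union>q. B 0 (rat_emb q))"
proof (intro equalityI subsetI)
  fix x assume x: "x \<in> K"
  obtain q where "d x (rat_emb q) < 1"
    by (rule Qp_rat_dense[OF x zero_less_one])
  then have "x \<in> B 0 (rat_emb q)"
    using x by (simp add: commute)
  then show "x \<in> (\<Union>q. B 0 (rat_emb q))"
    by (rule UN_I[OF UNIV_I])
qed auto

lemma standard_haar_unique:
  assumes "standard_Qp_haar p \<mu>"
  shows "\<mu> = hausdorff_borel"
proof -
  have sets: "sets \<mu> = sigma_sets K balls"
    using assms by (simp add: standard_Qp_haar_def haar_measure_def sets_borel_Qp)
  have ball: "emeasure \<mu> (B n x) = ennreal ((1 / real p) ^ n)" if "x \<in> K" for n x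
  proof (rule invariant_measure_ball[OF sets _ _ that])
    show "emeasure \<mu> ((\<lambda>y. g \<oplus>\<^bsub>Qp p\<^esub> y) ` A) = emeasure \<mu> A" if "g \<in> K" "A \<in> Sigma_Algebra.sets \<mu>" for g A
      using assms that by (simp add: standard_Qp_haar_def haar_measure_def)
    show "emeasure \<mu> (B 0 (rat_emb 0)) = 1"
      using assms by (simp only: standard_Qp_haar_def Zp_eq_ball)
  qed
  show ?thesis
  proof (rule measure_eqI_generator_eq_countable[OF Int_stable_Qp_balls balls_subset_Pow _ sets sets_hausdorff_borel])
    fix S assume "S \<in> balls"
    then consider "S = {}" | n x where "S = B n x" "x \<in> K"
      by blast
    then show "emeasure \<mu> S = emeasure hausdorff_borel S"
      by cases (simp_all only: ball emeasure_hausdorff_borel_ball emeasure_empty)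
  next
    show "(\<lambda>q. B 0 (rat_emb q)) ` UNIV \<subseteq> balls"
    proof
      fix S assume "S \<in> (\<lambda>q. B 0 (rat_emb q)) ` UNIV"
      then obtain q where "S = B 0 (rat_emb q)"
        by (elim imageE) (rule that)
      then show "S \<in> balls"
        using rat_emb_closed by blast
    qed
    show "\<Union>((\<lambda>q. B 0 (rat_emb q)) ` UNIV) = K"
      by (rule countable_unit_ball_cover[symmetric])
    show "countable ((\<lambda>q. B 0 (rat_emb q)) ` UNIV)"
      by simp
    show "emeasure \<mu> S \<noteq> \<infinity>" if "S \<in> (\<lambda>q. B 0 (rat_emb q)) ` UNIV" for S
      using that ball[OF rat_emb_closed] by (elim imageE) (simp only: ennreal_neq_top infinity_ennreal_def not_False_eq_True)
  qed
qed

section \<open>Hausdorff dimension\<close>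

lemma Qp_dist_powr: "Qp_dist p \<alpha> = (\<lambda>x y. d x y powr \<alpha>)"
  by (auto simp: Qp_dist_def Qp_abs_nonneg fun_eq_iff)

lemma hausdorff_measure_Qp_dist:
  "\<alpha> > 0 \<Longrightarrow> hausdorff_measure K (Qp_dist p \<alpha>) (1 / \<alpha>) A = h A"
  using hausdorff_measure_powr[where d=d, of \<alpha> K "1 / \<alpha>" A] by (simp add: Qp_dist_powr[of \<alpha>])

text \<open>A set that contains a ball has positive \<open>1 / \<alpha>\<close>-dimensional measure, and it is covered by countably many
unit balls of measure \<open>1\<close>. This applies to the whole space and to every neighborhood of a point alike.\<close>

lemma hausdorff_dim_Qp:
  assumes \<alpha>: "\<alpha> > 0" and x: "x \<in> K" and A: "A \<subseteq> K" "B n x \<subseteq> A"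
  shows "hausdorff_dim K (Qp_dist p \<alpha>) A = ennreal (1 / \<alpha>)"
proof (rule hausdorff_dim_eqI)
  show "0 < 1 / \<alpha>"
    using \<alpha> by simp
  have "ennreal ((1 / real p) ^ n) \<le> h A"
    using hausdorff_measure_mono[OF A(2), of K d 1] hausdorff_ball[OF x, of n] by simp
  then show "hausdorff_measure K (Qp_dist p \<alpha>) (1 / \<alpha>) A \<noteq> 0"
    using one_over_prime_power(1)[of n] by (auto simp: hausdorff_measure_Qp_dist[OF \<alpha>] ennreal_eq_0_iff simp del: power_eq_0_iff zero_less_power_eq)
  show "A \<subseteq> (\<Union>i. B 0 (rat_emb (from_nat i)))"
  proof
    fix y assume "y \<in> A"
    then have "y \<in> (\<Union>q. B 0 (rat_emb q))"
      using A(1) by (intro subsetD[OF equalityD1[OF countable_unit_ball_cover]]) auto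
    then obtain q where "y \<in> B 0 (rat_emb q)"
      by (elim UN_E) (rule that)
    then show "y \<in> (\<Union>i. B 0 (rat_emb (from_nat i)))"
      by (intro UN_I[of "to_nat q"]) (simp_all only: from_nat_to_nat UNIV_I)
  qed
  show "hausdorff_measure K (Qp_dist p \<alpha>) (1 / \<alpha>) (B 0 (rat_emb (from_nat i))) < \<infinity>" for i
    unfolding hausdorff_measure_Qp_dist[OF \<alpha>] hausdorff_ball[OF rat_emb_closed] by simp
qed

lemma local_hausdorff_dim_Qp:
  assumes \<alpha>: "\<alpha> > 0" and x: "x \<in> K"
  shows "local_hausdorff_dim K (Qp_dist p \<alpha>) K x = ennreal (1 / \<alpha>)"
proof -
  interpret A: Metric_space K "Qp_dist p \<alpha>"
    by (rule Metric_space_Qp[OF prime_p \<alpha>])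
  have "hausdorff_dim K (Qp_dist p \<alpha>) (K \<inter> U) = ennreal (1 / \<alpha>)"
    if U: "openin A.mtopology U" "x \<in> U" for U
  proof -
    obtain r where r: "r > 0" "A.mball x r \<subseteq> U"
      using U unfolding A.openin_mtopology by blast
    obtain n where n: "(1 / real p) ^ n < r powr (1 / \<alpha>)"
      using ex_one_over_prime_power_less[of "r powr (1 / \<alpha>)"] r(1) by auto
    have "y \<in> A.mball x r" if "y \<in> B n x" for y
    proof -
      have y: "y \<in> K" "d x y < r powr (1 / \<alpha>)"
        using that n by auto
      then have "d x y powr \<alpha> < (r powr (1 / \<alpha>)) powr \<alpha>"
        using \<alpha> by (intro powr_less_mono2) auto
      then show ?thesis
        unfolding A.in_mball using x y(1) \<alpha> r(1) by (simp add: Qp_dist_powr[of \<alpha>] powr_powr)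
    qed
    then have "B n x \<subseteq> K \<inter> U"
      by (intro Int_greatest mcball_subset_mspace order_trans[OF _ r(2)] subsetI)
    then show ?thesis
      by (rule hausdorff_dim_Qp[OF \<alpha> x Int_lower1])
  qed
  moreover have "openin A.mtopology K"
    by simp
  ultimately show ?thesis
    unfolding local_hausdorff_dim_def using x by (intro INF_eq_const) blast+
qed

end

theorem theorem3:
  fixes p :: nat and \<alpha> :: real
  assumes "prime p" and "\<alpha> > 0"
  shows "(\<exists>!\<mu>. standard_Qp_haar p \<mu>) \<and>
    (\<forall>\<mu>. standard_Qp_haar p \<mu> \<longrightarrow>
       (\<forall>A \<in> sets (borel_of (Qp_topology p)).
          hausdorff_measure (carrier (Qp p)) (Qp_dist p \<alpha>) (1 / \<alpha>) A = emeasure \<mu> A)) \<and>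
    hausdorff_dim (carrier (Qp p)) (Qp_dist p \<alpha>) (carrier (Qp p)) = ennreal (1 / \<alpha>) \<and>
    (\<forall>x \<in> carrier (Qp p).
       local_hausdorff_dim (carrier (Qp p)) (Qp_dist p \<alpha>) (carrier (Qp p)) x = ennreal (1 / \<alpha>))"
proof -
  interpret padic p
    by unfold_locales (rule assms(1))
  have "\<exists>!\<mu>. standard_Qp_haar p \<mu>"
    using standard_haar_hausdorff_borel standard_haar_unique by (intro ex1I)
  moreover have "hausdorff_measure K (Qp_dist p \<alpha>) (1 / \<alpha>) A = emeasure \<mu> A"
    if "standard_Qp_haar p \<mu>" "A \<in> sets (borel_of (Qp_topology p))" for \<mu> A
    using that(2) hausdorff_measure_Qp_dist[OF assms(2)] emeasure_hausdorff_borel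
    by (simp add: standard_haar_unique[OF that(1)] sets_borel_Qp sets_hausdorff_borel)
  moreover have "hausdorff_dim K (Qp_dist p \<alpha>) K = ennreal (1 / \<alpha>)"
    by (rule hausdorff_dim_Qp[OF assms(2) rat_emb_closed order_refl mcball_subset_mspace])
  ultimately show ?thesis
    using local_hausdorff_dim_Qp[OF assms(2)] by (intro conjI allI impI ballI)
qed

end
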